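(* Assume that $G$ is a commutative, compactly generated, locally compact Hausdorff group. (1) If $G$ is topologically isomorphic to $\mathbb R^a\times\mathbb Z^b\times C$ for some integers $a,b\ge0$ and some compact, commutative group $C$, then $\mathcal LG=\mathbb S^{a+b-1}$ and $\mathcal PG=\mathbb P^{a+b-1}$ (up to homeomorphism). (2) If $H$ is a closed subgroup of $G$ such that $G/H$ is compact, then $\mathcal LH=\mathcal LG$ and $\mathcal PH=\mathcal PG$ (up to homeomorphism).
   Context: Metric setting. Let $(X,d)$ be a metric space with a fixed reference point $o\in X$ and closed balls $B(x,r)$. For $R\subseteq X$ and $\alpha,a\ge0$ put $\alpha R+a=\bigcup_{x\in R}B(x,\alpha d(o,x)+a)$. For unbounded $R,S\subseteq X$ let $s^+(R,S)$ be the infimum of all $\alpha\ge0$ such that $S\subseteq\alpha R+a$ for some $a\ge0$; put $s(R,S)=\max\{s^+(R,S),s^+(S,R)\}$ and $t(R,S)=\sqrt{s(R,S)}$. Let $\mathcal U$ be the family of unbounded subsets and write $R\sim S$ if $s(R,S)=0$; this is an equivalence relation and $t$ induces a metric on $\mathcal U/{\sim}$. For $\mathcal E\subseteq\mathcal U$ let $\mathcal E/{\sim}\subseteq\mathcal U/{\sim}$ be the set of classes containing an element of $\mathcal E$, and $\mathrm{cl}(\mathcal E/{\sim})$ its closure in $(\mathcal U/{\sim},t)$. Groups. Compactly generated, locally compact Hausdorff groups are equipped with a word metric $d(g,h)=\inf\{n\ge0: g^{-1}h\in S^n\}$ for a compact generating set $S=S^{-1}$ (the topological spaces below do not depend on the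 choice). The linear boundary is $\mathcal LG=\mathrm{cl}(\mathcal C^+G/{\sim})$ with $\mathcal C^+G=\{\langle g\rangle^+: g\in G,\ \langle g\rangle^+\text{ unbounded}\}$, $\langle g\rangle^+=\{g^n:n\ge0\}$; the projective boundary is $\mathcal PG=\mathrm{cl}(\mathcal CG/{\sim})$ with $\mathcal CG=\{\langle g\rangle: g\in G,\ \langle g\rangle\text{ unbounded}\}$, $\langle g\rangle=\{g^n:n\in\mathbb Z\}$. $\mathbb S^k$ and $\mathbb P^k$ are the $k$-dimensional sphere and real projective space; $\mathbb S^{-1}=\mathbb P^{-1}=\emptyset$. In part (2) the group $H$ is again compactly generated and locally compact and carries its own word metric. *)

theory Defs
  imports "HOL-Analysis.Analysis" "HOL-Algebra.Product_Groups"
begin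

text \<open>Otherwise \<open>closure_of\<close> from \<open>HOL-Algebra.Congruence\<close> makes the topological one ambiguous.\<close>

no_notation eq_closure_of (\<open>closure'_of\<index>\<close>)

section \<open>The metric space of classes of unbounded sets\<close>

locale pointed_metric_space = Metric_space +
  fixes p :: 'a
  assumes base_in [simp]: "p \<in> M"
begin

definition enlarge :: "real \<Rightarrow> 'a set \<Rightarrow> real \<Rightarrow> 'a set" where
  "enlarge \<alpha> R a = (\<Union>x\<in>R. mcball x (\<alpha> * d p x + a))"

definition unbounded_sets :: "'a set set" where
  "unbounded_sets = {R. R \<subseteq> M \<and> \<not> mbounded R}"

text \<open>For unbounded \<open>R\<close> the infimum is over a nonempty set, since every \<open>\<alpha> > 1\<close> is admissible
  (lemma \<open>enlarge_covers\<close>); a real infimum therefore suffices.\<close>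

definition s_plus :: "'a set \<Rightarrow> 'a set \<Rightarrow> real" where
  "s_plus R S = Inf {\<alpha>. 0 \<le> \<alpha> \<and> (\<exists>a\<ge>0. S \<subseteq> enlarge \<alpha> R a)}"

definition s_dist :: "'a set \<Rightarrow> 'a set \<Rightarrow> real" where
  "s_dist R S = max (s_plus R S) (s_plus S R)"

definition t_dist :: "'a set \<Rightarrow> 'a set \<Rightarrow> real" where
  "t_dist R S = sqrt (s_dist R S)"

definition asym_rel :: "('a set \<times> 'a set) set" where
  "asym_rel = {(R, S). R \<in> unbounded_sets \<and> S \<in> unbounded_sets \<and> s_dist R S = 0}"

definition asym_classes :: "'a set set set" where
  "asym_classes = unbounded_sets // asym_rel"

text \<open>The distance of two classes is the distance of arbitrary representatives
  (lemma \<open>class_dist_eq\<close>). The value \<open>0\<close> off the carrier is only there because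
  \<open>Metric_space\<close> demands symmetry and nonnegativity everywhere.\<close>

definition class_dist :: "'a set set \<Rightarrow> 'a set set \<Rightarrow> real" where
  "class_dist A B =
    (if A \<in> asym_classes \<and> B \<in> asym_classes
     then t_dist (SOME R. R \<in> A) (SOME S. S \<in> B) else 0)"

definition class_topology :: "'a set set topology" where
  "class_topology = Metric_space.mtopology asym_classes class_dist"

definition boundary :: "'a set set \<Rightarrow> 'a set set topology" where
  "boundary E = subtopology class_topology (class_topology closure_of (E // asym_rel))"

lemma unbounded_far:
  assumes "R \<in> unbounded_sets"
  obtains x where "x \<in> R" "x \<in> M" "B < d p x"
proof -
  have "\<exists>x\<in>R. B < d p x"
  proof (rule ccontr)
    assume "\<not> (\<exists>x\<in>R. B < d p x)"
    then have "R \<subseteq> mcball p B"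
      using assms by (auto simp: unbounded_sets_def not_less)
    then show False
      using assms by (auto simp: unbounded_sets_def mbounded_def)
  qed
  then show thesis
    using that assms by (auto simp: unbounded_sets_def)
qed

lemma in_enlarge:
  "y \<in> enlarge \<alpha> R a \<longleftrightarrow> (\<exists>x\<in>R. x \<in> M \<and> y \<in> M \<and> d x y \<le> \<alpha> * d p x + a)"
  by (auto simp: enlarge_def)

lemma enlarge_covers:
  assumes R: "R \<in> unbounded_sets" and S: "S \<subseteq> M" and "1 < \<alpha>"
  shows "S \<subseteq> enlarge \<alpha> R 0"
proof
  fix y assume "y \<in> S"
  then have y: "y \<in> M" using S by auto
  obtain x where x: "x \<in> R" "x \<in> M" "d p y / (\<alpha> - 1) < d p x"
    using unbounded_far[OF R] by blast
  have "d p y \<le> (\<alpha> - 1) * d p x"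
    using x(3) \<open>1 < \<alpha>\<close> by (simp add: field_simps)
  moreover have "d x y \<le> d p x + d p y"
    using triangle[of x p y] x y by (simp add: commute)
  ultimately show "y \<in> enlarge \<alpha> R 0"
    using x y by (auto simp: in_enlarge algebra_simps)
qed

lemma s_plus_bdd: "bdd_below {\<alpha>. 0 \<le> \<alpha> \<and> (\<exists>a\<ge>0. S \<subseteq> enlarge \<alpha> R a)}"
  by (rule bdd_belowI[of _ 0]) auto

lemma s_plus_le:
  assumes "0 \<le> \<alpha>" "0 \<le> a" "S \<subseteq> enlarge \<alpha> R a"
  shows "s_plus R S \<le> \<alpha>"
  unfolding s_plus_def using assms by (intro cInf_lower s_plus_bdd) auto

lemma s_plus_nonempty:
  assumes "R \<in> unbounded_sets" "S \<in> unbounded_sets"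
  shows "{\<alpha>. 0 \<le> \<alpha> \<and> (\<exists>a\<ge>0. S \<subseteq> enlarge \<alpha> R a)} \<noteq> {}"
proof -
  have "S \<subseteq> enlarge 2 R 0"
    using assms by (intro enlarge_covers) (auto simp: unbounded_sets_def)
  then have "2 \<in> {\<alpha>. 0 \<le> \<alpha> \<and> (\<exists>a\<ge>0. S \<subseteq> enlarge \<alpha> R a)}"
    by (auto intro!: exI[of _ 0])
  then show ?thesis by blast
qed

lemma s_plus_nonneg:
  assumes "R \<in> unbounded_sets" "S \<in> unbounded_sets"
  shows "0 \<le> s_plus R S"
  unfolding s_plus_def using s_plus_nonempty[OF assms] by (intro cInf_greatest) auto

lemma s_plus_le_1:
  assumes "R \<in> unbounded_sets" "S \<in> unbounded_sets"
  shows "s_plus R S \<le> 1"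
proof (rule field_le_epsilon)
  fix e :: real assume "0 < e"
  then have "S \<subseteq> enlarge (1 + e) R 0"
    using assms by (intro enlarge_covers) (auto simp: unbounded_sets_def)
  then show "s_plus R S \<le> 1 + e"
    using \<open>0 < e\<close> by (intro s_plus_le[of _ 0]) auto
qed

lemma s_plus_approx:
  assumes "R \<in> unbounded_sets" "S \<in> unbounded_sets" "s_plus R S < c"
  obtains \<alpha> a where "0 \<le> \<alpha>" "\<alpha> < c" "0 \<le> a" "S \<subseteq> enlarge \<alpha> R a"
  using cInf_lessD[OF s_plus_nonempty[OF assms(1,2)]] assms(3) that
  unfolding s_plus_def by blast

lemma s_plus_refl:
  assumes "R \<in> unbounded_sets"
  shows "s_plus R R = 0"
proof (rule antisym)
  have "x \<in> enlarge 0 R 0" if "x \<in> R" for x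
    using assms that by (auto simp: in_enlarge unbounded_sets_def intro!: bexI[of _ x])
  then have "R \<subseteq> enlarge 0 R 0" by blast
  then show "s_plus R R \<le> 0"
    by (intro s_plus_le[of _ 0]) auto
qed (use s_plus_nonneg assms in auto)

lemma enlarge_trans:
  assumes "0 \<le> \<beta>" "S \<subseteq> enlarge \<alpha> R a" "T \<subseteq> enlarge \<beta> S b"
  shows "T \<subseteq> enlarge (\<alpha> + \<beta> + \<alpha> * \<beta>) R (a + b + \<beta> * a)"
proof
  fix z assume "z \<in> T"
  then obtain y where y: "y \<in> S" "y \<in> M" "z \<in> M" "d y z \<le> \<beta> * d p y + b"
    using subsetD[OF assms(3)] by (auto simp: in_enlarge)
  then obtain x where x: "x \<in> R" "x \<in> M" "d x y \<le> \<alpha> * d p x + a"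
    using subsetD[OF assms(2)] by (auto simp: in_enlarge)
  have "d p y \<le> d p x + (\<alpha> * d p x + a)"
    using triangle[of p x y] x y by simp
  then have "\<beta> * d p y \<le> \<beta> * (d p x + (\<alpha> * d p x + a))"
    using assms(1) by (rule mult_left_mono)
  then have "d x z \<le> (\<alpha> + \<beta> + \<alpha> * \<beta>) * d p x + (a + b + \<beta> * a)"
    using triangle[of x y z] x y by (simp add: algebra_simps)
  then show "z \<in> enlarge (\<alpha> + \<beta> + \<alpha> * \<beta>) R (a + b + \<beta> * a)"
    using x y by (auto simp: in_enlarge)
qed

lemma s_plus_triangle:
  assumes U: "R \<in> unbounded_sets" "S \<in> unbounded_sets" "T \<in> unbounded_sets"
  shows "1 + s_plus R T \<le> (1 + s_plus R S) * (1 + s_plus S T)"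
proof (rule tendsto_lowerbound)
  let ?f = "\<lambda>e. (1 + (s_plus R S + e)) * (1 + (s_plus S T + e))"
  show "(?f \<longlongrightarrow> (1 + s_plus R S) * (1 + s_plus S T)) (at_right 0)"
    by (auto intro!: tendsto_eq_intros)
  show "\<forall>\<^sub>F e in at_right 0. 1 + s_plus R T \<le> ?f e"
  proof (rule eventually_at_rightI[of _ 1])
    fix e :: real assume "e \<in> {0<..<1}"
    then have e: "0 < e" by auto
    obtain \<alpha> a where a: "0 \<le> \<alpha>" "\<alpha> < s_plus R S + e" "0 \<le> a" "S \<subseteq> enlarge \<alpha> R a"
      using s_plus_approx[OF U(1,2)] e by (metis less_add_same_cancel1)
    obtain \<beta> b where b: "0 \<le> \<beta>" "\<beta> < s_plus S T + e" "0 \<le> b" "T \<subseteq> enlarge \<beta> S b"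
      using s_plus_approx[OF U(2,3)] e by (metis less_add_same_cancel1)
    have "s_plus R T \<le> \<alpha> + \<beta> + \<alpha> * \<beta>"
      using a b by (intro s_plus_le[OF _ _ enlarge_trans[OF b(1) a(4) b(4)]]) auto
    then have "1 + s_plus R T \<le> (1 + \<alpha>) * (1 + \<beta>)"
      by (simp add: algebra_simps)
    also have "\<dots> \<le> ?f e"
      using a b by (intro mult_mono) auto
    finally show "1 + s_plus R T \<le> ?f e" .
  qed simp
qed simp

lemma s_dist_nonneg:
  assumes "R \<in> unbounded_sets" "S \<in> unbounded_sets"
  shows "0 \<le> s_dist R S"
  using s_plus_nonneg[OF assms] by (simp add: s_dist_def)

lemma s_dist_commute: "s_dist R S = s_dist S R"
  by (simp add: s_dist_def max.commute)

lemma s_dist_triangle: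
  assumes U: "R \<in> unbounded_sets" "S \<in> unbounded_sets" "T \<in> unbounded_sets"
  shows "1 + s_dist R T \<le> (1 + s_dist R S) * (1 + s_dist S T)"
proof -
  have "(1 + s_plus R S) * (1 + s_plus S T) \<le> (1 + s_dist R S) * (1 + s_dist S T)"
    using U by (intro mult_mono) (auto simp: s_dist_def s_plus_nonneg le_max_iff_disj)
  moreover have "(1 + s_plus T S) * (1 + s_plus S R) \<le> (1 + s_dist S T) * (1 + s_dist R S)"
    using U by (intro mult_mono) (auto simp: s_dist_def s_plus_nonneg le_max_iff_disj)
  moreover note s_plus_triangle[OF U] s_plus_triangle[OF U(3,2,1)]
  ultimately show ?thesis
    by (simp add: s_dist_def[of R T] mult.commute)
qed

lemma t_dist_triangle:
  assumes U: "R \<in> unbounded_sets" "S \<in> unbounded_sets" "T \<in> unbounded_sets"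
  shows "t_dist R T \<le> t_dist R S + t_dist S T"
proof -
  define u v where "u = t_dist R S" and "v = t_dist S T"
  have u: "0 \<le> u" "u \<le> 1" "u\<^sup>2 = s_dist R S" and v: "0 \<le> v" "v \<le> 1" "v\<^sup>2 = s_dist S T"
    using U s_dist_nonneg s_plus_le_1 by (auto simp: u_def v_def t_dist_def s_dist_def)
  have "u * v * (u * v) \<le> 1 * (u * v)"
    using u v by (intro mult_right_mono mult_le_one) auto
  moreover have "0 \<le> u * v" using u v by simp
  ultimately have "u\<^sup>2 * v\<^sup>2 \<le> 2 * (u * v)"
    by (simp add: power2_eq_square algebra_simps)
  then have "s_dist R T \<le> (u + v)\<^sup>2"
    using s_dist_triangle[OF U] u(3) v(3) by (simp add: power2_sum algebra_simps)
  then show ?thesis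
    unfolding t_dist_def[of R T] u_def[symmetric] v_def[symmetric]
    using u v by (intro real_le_lsqrt) auto
qed

lemma t_dist_eq_0_iff: "t_dist R S = 0 \<longleftrightarrow> s_dist R S = 0"
  by (simp add: t_dist_def)

lemma t_dist_nonneg:
  assumes "R \<in> unbounded_sets" "S \<in> unbounded_sets"
  shows "0 \<le> t_dist R S"
  using s_dist_nonneg[OF assms] by (simp add: t_dist_def)

lemma t_dist_commute: "t_dist R S = t_dist S R"
  by (simp add: t_dist_def s_dist_commute)

lemma equiv_asym_rel: "equiv unbounded_sets asym_rel"
proof (rule equivI)
  show "asym_rel \<subseteq> unbounded_sets \<times> unbounded_sets"
    by (auto simp: asym_rel_def)
  show "refl_on unbounded_sets asym_rel"
    by (auto simp: refl_on_def asym_rel_def s_dist_def s_plus_refl)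
  show "sym asym_rel"
    by (auto simp: sym_def asym_rel_def s_dist_commute)
  show "trans asym_rel"
  proof (rule transI)
    fix R S T assume "(R, S) \<in> asym_rel" "(S, T) \<in> asym_rel"
    then show "(R, T) \<in> asym_rel"
      using s_dist_triangle[of R S T] s_dist_nonneg[of R T]
      by (auto simp: asym_rel_def)
  qed
qed

lemma class_dist_eq:
  assumes A: "A \<in> asym_classes" "R \<in> A" and B: "B \<in> asym_classes" "S \<in> B"
  shows "class_dist A B = t_dist R S"
proof -
  define R' S' where "R' = (SOME R. R \<in> A)" and "S' = (SOME S. S \<in> B)"
  have "R' \<in> A" "S' \<in> B"
    using A B unfolding R'_def S'_def by (auto intro: someI)
  then have "(R, R') \<in> asym_rel" "(S, S') \<in> asym_rel"
    using A B quotient_eq_iff[OF equiv_asym_rel] by (auto simp: asym_classes_def)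
  then have U: "R \<in> unbounded_sets" "R' \<in> unbounded_sets"
      "S \<in> unbounded_sets" "S' \<in> unbounded_sets"
    and z: "t_dist R R' = 0" "t_dist S S' = 0"
    by (auto simp: asym_rel_def t_dist_eq_0_iff)
  have "t_dist R S = t_dist R' S'"
    using t_dist_triangle[of R R' S] t_dist_triangle[of R' S' S]
      t_dist_triangle[of R' R S'] t_dist_triangle[of R S S'] U z
    by (simp add: t_dist_commute[of R' R] t_dist_commute[of S' S])
  then show ?thesis
    using A B by (simp add: class_dist_def R'_def S'_def)
qed

sublocale classes: Metric_space asym_classes class_dist
proof
  have rep: "\<exists>R. R \<in> A \<and> R \<in> unbounded_sets" if "A \<in> asym_classes" for A
    using that equiv_class_self[OF equiv_asym_rel]
    by (auto simp: asym_classes_def quotient_def)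
  fix A B
  show "0 \<le> class_dist A B"
  proof (cases "A \<in> asym_classes \<and> B \<in> asym_classes")
    case True
    then show ?thesis
      using rep[of A] rep[of B] class_dist_eq[of A _ B] t_dist_nonneg by metis
  qed (auto simp: class_dist_def)
  show "class_dist A B = class_dist B A"
    by (auto simp: class_dist_def t_dist_commute)
  show "class_dist A B = 0 \<longleftrightarrow> A = B" if AB: "A \<in> asym_classes" "B \<in> asym_classes"
  proof -
    obtain R S where RS: "R \<in> A" "R \<in> unbounded_sets" "S \<in> B" "S \<in> unbounded_sets"
      using rep AB by blast
    have "class_dist A B = 0 \<longleftrightarrow> (R, S) \<in> asym_rel"
      using class_dist_eq[OF AB(1) RS(1) AB(2) RS(3)] RS
      by (simp add: asym_rel_def t_dist_eq_0_iff)
    also have "\<dots> \<longleftrightarrow> A = B"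
      using quotient_eq_iff[OF equiv_asym_rel] AB RS by (metis asym_classes_def)
    finally show ?thesis .
  qed
  show "class_dist A C \<le> class_dist A B + class_dist B C"
    if ABC: "A \<in> asym_classes" "B \<in> asym_classes" "C \<in> asym_classes" for C
  proof -
    obtain R where R: "R \<in> A" "R \<in> unbounded_sets" using rep ABC(1) by blast
    obtain S where S: "S \<in> B" "S \<in> unbounded_sets" using rep ABC(2) by blast
    obtain T where T: "T \<in> C" "T \<in> unbounded_sets" using rep ABC(3) by blast
    show ?thesis
      using t_dist_triangle[OF R(2) S(2) T(2)] ABC R(1) S(1) T(1)
      by (simp add: class_dist_eq[of A R C T] class_dist_eq[of A R B S] class_dist_eq[of B S C T])
  qed
qed

end

section \<open>Topological groups and their boundaries\<close>

locale topological_group = group G for G (structure) +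
  fixes T :: "'a topology"
  assumes topspace_eq: "topspace T = carrier G"
    and continuous_mult: "continuous_map (prod_topology T T) T (\<lambda>(x, y). x \<otimes> y)"
    and continuous_inv: "continuous_map T T (\<lambda>x. inv x)"

definition compact_generating_set ::
    "('a, 'm) monoid_scheme \<Rightarrow> 'a topology \<Rightarrow> 'a set \<Rightarrow> bool" where
  "compact_generating_set G T S \<longleftrightarrow>
     compactin T S \<and> set_inv\<^bsub>G\<^esub> S = S \<and> generate G S = carrier G"

primrec set_pow :: "('a, 'm) monoid_scheme \<Rightarrow> 'a set \<Rightarrow> nat \<Rightarrow> 'a set" where
  "set_pow G S 0 = {\<one>\<^bsub>G\<^esub>}"
| "set_pow G S (Suc n) = S <#>\<^bsub>G\<^esub> set_pow G S n"

text \<open>The value \<open>0\<close> off the carrier makes this an instance of \<open>Metric_space\<close>, which demands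
  symmetry everywhere (lemma \<open>pointed_metric_space_word_metric\<close>).\<close>

definition word_metric :: "('a, 'm) monoid_scheme \<Rightarrow> 'a set \<Rightarrow> 'a \<Rightarrow> 'a \<Rightarrow> real" where
  "word_metric G S g h =
    (if g \<in> carrier G \<and> h \<in> carrier G
     then real (Inf {n. inv\<^bsub>G\<^esub> g \<otimes>\<^bsub>G\<^esub> h \<in> set_pow G S n}) else 0)"

definition forward_orbits :: "('a, 'm) monoid_scheme \<Rightarrow> 'a set set" where
  "forward_orbits G = {range (\<lambda>n::nat. g [^]\<^bsub>G\<^esub> n) |g. g \<in> carrier G}"

definition full_orbits :: "('a, 'm) monoid_scheme \<Rightarrow> 'a set set" where
  "full_orbits G = {range (\<lambda>n::int. g [^]\<^bsub>G\<^esub> n) |g. g \<in> carrier G}"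

definition linear_boundary ::
    "('a, 'm) monoid_scheme \<Rightarrow> 'a set \<Rightarrow> 'a \<Rightarrow> 'a set set topology" where
  "linear_boundary G S p =
    pointed_metric_space.boundary (carrier G) (word_metric G S) p
      (forward_orbits G \<inter>
       pointed_metric_space.unbounded_sets (carrier G) (word_metric G S))"

definition projective_boundary ::
    "('a, 'm) monoid_scheme \<Rightarrow> 'a set \<Rightarrow> 'a \<Rightarrow> 'a set set topology" where
  "projective_boundary G S p =
    pointed_metric_space.boundary (carrier G) (word_metric G S) p
      (full_orbits G \<inter>
       pointed_metric_space.unbounded_sets (carrier G) (word_metric G S))"

context group
begin

lemma set_pow_subset: "S \<subseteq> carrier G \<Longrightarrow> set_pow G S n \<subseteq> carrier G"
  by (induction n) (auto simp: set_mult_def)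

lemma set_pow_add:
  assumes S: "S \<subseteq> carrier G" and "g \<in> set_pow G S m" "h \<in> set_pow G S n"
  shows "g \<otimes> h \<in> set_pow G S (m + n)"
  using assms(2)
proof (induction m arbitrary: g)
  case 0
  then show ?case
    using assms(3) set_pow_subset[OF S, of n] by auto
next
  case (Suc m)
  then obtain s k where sk: "s \<in> S" "k \<in> set_pow G S m" "g = s \<otimes> k"
    by (auto simp: set_mult_def)
  then have "g \<otimes> h = s \<otimes> (k \<otimes> h)"
    using S set_pow_subset[OF S] assms(3) by (metis m_assoc subsetD)
  then show ?case
    using Suc.IH[OF sk(2)] sk(1) by (auto simp: set_mult_def)
qed

lemma set_pow_1: "S \<subseteq> carrier G \<Longrightarrow> s \<in> S \<Longrightarrow> s \<in> set_pow G S 1"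
  by (force simp: set_mult_def)

lemma set_pow_inv:
  assumes S: "S \<subseteq> carrier G" and sym: "set_inv S = S" and "g \<in> set_pow G S n"
  shows "inv g \<in> set_pow G S n"
  using assms(3)
proof (induction n arbitrary: g)
  case (Suc n)
  then obtain s k where sk: "s \<in> S" "k \<in> set_pow G S n" "g = s \<otimes> k"
    by (auto simp: set_mult_def)
  have "inv s \<in> S" using sk(1) sym by (auto simp: SET_INV_def)
  then have "inv k \<otimes> inv s \<in> set_pow G S (n + 1)"
    using Suc.IH[OF sk(2)] by (intro set_pow_add set_pow_1 S)
  moreover have "inv g = inv k \<otimes> inv s"
    using sk S set_pow_subset[OF S] by (auto intro!: inv_mult_group)
  ultimately show ?case by simp
qed simp

lemma generate_set_pow:
  assumes S: "S \<subseteq> carrier G" and sym: "set_inv S = S" and "g \<in> generate G S"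
  shows "\<exists>n. g \<in> set_pow G S n"
  using assms(3)
proof induction
  case one
  show ?case by (rule exI[of _ 0]) simp
next
  case (incl h)
  then show ?case using set_pow_1[OF S] by blast
next
  case (inv h)
  then have "m_inv G h \<in> S" using sym by (auto simp: SET_INV_def)
  then show ?case using set_pow_1[OF S] by blast
next
  case (eng h1 h2)
  then show ?case using set_pow_add[OF S] by blast
qed

lemma pointed_metric_space_word_metric:
  assumes S: "S \<subseteq> carrier G" and sym: "set_inv S = S" and gen: "generate G S = carrier G"
    and p: "p \<in> carrier G"
  shows "pointed_metric_space (carrier G) (word_metric G S) p"
proof
  have attained: "inv g \<otimes> h \<in> set_pow G S (Inf {n. inv g \<otimes> h \<in> set_pow G S n})"
    if "g \<in> carrier G" "h \<in> carrier G" for g h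
  proof -
    have "{n. inv g \<otimes> h \<in> set_pow G S n} \<noteq> {}"
      using generate_set_pow[OF S sym, of "inv g \<otimes> h"] gen that by auto
    from Inf_nat_def1[OF this] show ?thesis by simp
  qed
  fix g h
  show "0 \<le> word_metric G S g h" by (simp add: word_metric_def)
  have flip: "inv h \<otimes> g \<in> set_pow G S n" 
    if "inv g \<otimes> h \<in> set_pow G S n" "g \<in> carrier G" "h \<in> carrier G" for g h n
    using set_pow_inv[OF S sym that(1)] that by (simp add: inv_mult_group)
  show "word_metric G S g h = word_metric G S h g"
  proof (cases "g \<in> carrier G \<and> h \<in> carrier G")
    case True
    then have "{n. inv g \<otimes> h \<in> set_pow G S n} = {n. inv h \<otimes> g \<in> set_pow G S n}"
      using flip by blast
    then show ?thesis by (simp add: word_metric_def)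
  qed (auto simp: word_metric_def)
  show "word_metric G S g h = 0 \<longleftrightarrow> g = h" if gh: "g \<in> carrier G" "h \<in> carrier G"
  proof
    assume "word_metric G S g h = 0"
    then have "inv g \<otimes> h = \<one>"
      using attained[OF gh] gh by (simp add: word_metric_def)
    then show "g = h" using gh by (metis inv_equality inv_inv inv_closed)
  next
    assume "g = h"
    then have "0 \<in> {n. inv g \<otimes> h \<in> set_pow G S n}" using gh by simp
    then have "Inf {n. inv g \<otimes> h \<in> set_pow G S n} = 0"
      by (metis cInf_lower bdd_below_bot le_zero_eq)
    then show "word_metric G S g h = 0" by (simp add: word_metric_def)
  qed
  show "word_metric G S g k \<le> word_metric G S g h + word_metric G S h k"
    if c: "g \<in> carrier G" "h \<in> carrier G" "k \<in> carrier G" for k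
  proof -
    have "inv g \<otimes> k = (inv g \<otimes> h) \<otimes> (inv h \<otimes> k)"
      using c by (metis inv_closed inv_solve_left m_assoc m_closed)
    then have "Inf {n. inv g \<otimes> h \<in> set_pow G S n} + Inf {n. inv h \<otimes> k \<in> set_pow G S n}
        \<in> {n. inv g \<otimes> k \<in> set_pow G S n}"
      using set_pow_add[OF S attained attained] c by auto
    then have "Inf {n. inv g \<otimes> k \<in> set_pow G S n}
        \<le> Inf {n. inv g \<otimes> h \<in> set_pow G S n} + Inf {n. inv h \<otimes> k \<in> set_pow G S n}"
      by (metis cInf_lower bdd_below_bot)
    then show ?thesis using c by (simp add: word_metric_def flip: of_nat_add)
  qed
  show "p \<in> carrier G" by fact
qed

end

definition topologically_isomorphic ::
    "('a, 'm) monoid_scheme \<Rightarrow> 'a topology \<Rightarrow> ('b, 'n) monoid_scheme \<Rightarrow> 'b topology \<Rightarrow> bool" where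
  "topologically_isomorphic G T K U \<longleftrightarrow> (\<exists>f \<in> iso G K. homeomorphic_map T U f)"

definition real_group :: "real monoid" where
  "real_group = \<lparr>carrier = UNIV, monoid.mult = (+), one = 0\<rparr>"

text \<open>The model \<open>\<real>\<^sup>a \<times> \<int>\<^sup>b \<times> C\<close>; elements of the first two factors are extensional functions
  on \<open>{..<a}\<close> and \<open>{..<b}\<close>.\<close>

definition model_group ::
    "nat \<Rightarrow> nat \<Rightarrow> ('c, 'n) monoid_scheme \<Rightarrow> ((nat \<Rightarrow> real) \<times> (nat \<Rightarrow> int) \<times> 'c) monoid" where
  "model_group a b C =
    product_group {..<a} (\<lambda>_. real_group) \<times>\<times> (product_group {..<b} (\<lambda>_. integer_group) \<times>\<times> C)"

definition model_topology ::
    "nat \<Rightarrow> nat \<Rightarrow> 'c topology \<Rightarrow> ((nat \<Rightarrow> real) \<times> (nat \<Rightarrow> int) \<times> 'c) topology" where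
  "model_topology a b TC =
    prod_topology (product_topology (\<lambda>_. euclideanreal) {..<a})
      (prod_topology (product_topology (\<lambda>_. discrete_topology UNIV) {..<b}) TC)"

section \<open>Quotients, spheres and projective spaces\<close>

definition quotient_topology :: "'a topology \<Rightarrow> ('a \<Rightarrow> 'b) \<Rightarrow> 'b topology" where
  "quotient_topology X q =
    topology (\<lambda>U. U \<subseteq> q ` topspace X \<and> openin X {x \<in> topspace X. q x \<in> U})"

lemma openin_quotient_topology:
  "openin (quotient_topology X q) U \<longleftrightarrow>
     U \<subseteq> q ` topspace X \<and> openin X {x \<in> topspace X. q x \<in> U}"
proof -
  have "istopology (\<lambda>U. U \<subseteq> q ` topspace X \<and> openin X {x \<in> topspace X. q x \<in> U})"
    unfolding istopology_def
  proof (intro conjI allI impI)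
    fix U V
    assume "U \<subseteq> q ` topspace X \<and> openin X {x \<in> topspace X. q x \<in> U}"
      and "V \<subseteq> q ` topspace X \<and> openin X {x \<in> topspace X. q x \<in> V}"
    then have "openin X ({x \<in> topspace X. q x \<in> U} \<inter> {x \<in> topspace X. q x \<in> V})"
      by blast
    moreover have "{x \<in> topspace X. q x \<in> U} \<inter> {x \<in> topspace X. q x \<in> V}
        = {x \<in> topspace X. q x \<in> U \<inter> V}"
      by auto
    ultimately show "openin X {x \<in> topspace X. q x \<in> U \<inter> V}" by simp
  next
    fix \<K>
    assume K: "\<forall>U\<in>\<K>. U \<subseteq> q ` topspace X \<and> openin X {x \<in> topspace X. q x \<in> U}"
    then have "openin X (\<Union>U\<in>\<K>. {x \<in> topspace X. q x \<in> U})"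
      by blast
    moreover have "(\<Union>U\<in>\<K>. {x \<in> topspace X. q x \<in> U}) = {x \<in> topspace X. q x \<in> \<Union>\<K>}"
      by auto
    ultimately show "openin X {x \<in> topspace X. q x \<in> \<Union>\<K>}" by simp
  qed (use Sup_least in blast)+
  then show ?thesis
    by (simp add: quotient_topology_def)
qed

text \<open>Both spaces are indexed by the dimension of the ambient Euclidean space: \<open>sphere_in n\<close> is
  the \<open>(n-1)\<close>-sphere and \<open>projective_in n\<close> is \<open>(n-1)\<close>-dimensional projective space, so that
  \<open>n = 0\<close> gives the empty space.\<close>

definition sphere_in :: "nat \<Rightarrow> (nat \<Rightarrow> real) topology" where
  "sphere_in n = subtopology (Euclidean_space n) {x. (\<Sum>i<n. (x i)\<^sup>2) = 1}"

definition projective_in :: "nat \<Rightarrow> (nat \<Rightarrow> real) set topology" where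
  "projective_in n = quotient_topology (sphere_in n) (\<lambda>x. {x, \<lambda>i. - x i})"

lemma sphere_in_Suc: "sphere_in (Suc n) = nsphere n"
  by (simp add: sphere_in_def nsphere_def lessThan_Suc_atMost)

lemma sphere_in_0: "topspace (sphere_in 0) = {}"
  by (simp add: sphere_in_def)

definition coset_topology ::
    "('a, 'm) monoid_scheme \<Rightarrow> 'a topology \<Rightarrow> 'a set \<Rightarrow> 'a set topology" where
  "coset_topology G T H = quotient_topology T (\<lambda>x. H #>\<^bsub>G\<^esub> x)"

end

theory Submission
  imports Defs
begin

text \<open>The relation \<open>\<sim>\<close> and the metric \<open>t\<close> on its classes only see distances up to an additive
constant and, up to homeomorphism of the space of classes, up to a multiplicative constant. So the boundaries depend only on the
large-scale geometry of the group together with its cyclic subgroups, and the idea is to replace the group by a lattice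
\<open>\<int>\<^sup>k\<close> in it: a homomorphism \<open>\<psi>\<close> from \<open>\<int>\<^sup>k\<close> that is proper
(finitely many lattice points in each ball) and whose image is within bounded distance of every element (the predicate
\<open>lattice\<close>).

A lattice determines both boundaries (\<open>boundaries_if_lattice\<close>). Sending \<open>x\<close> to a lattice
vector whose image is close to \<open>x\<close> is an additive map up to a bounded error; homogenizing it gives a
homomorphism \<open>v\<close> into \<open>\<real>\<^sup>k\<close> which multiplies distances by bounded factors up to bounded errors
(\<open>lattice_chart\<close>). Hence the orbit of \<open>x\<close> looks like the ray, or the line, through \<open>v x\<close>, and it is
bounded exactly when \<open>v x = 0\<close>. Coarse rays (lines) in the directions \<open>u\<close> and \<open>u'\<close> are at distance
\<open>s \<le> const * norm (u - u')\<close>, and they are equivalent only if \<open>u' = u\<close> (respectively \<open>u' = u\<close> or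
\<open>u' = - u\<close>). So \<open>u \<mapsto> [cone J u]\<close> is a continuous map on the compact sphere; its image is closed, and
it is the closure of the classes of orbits because lattice directions are dense
(\<open>quotient_map_cone_class\<close>). A continuous surjection from a compact space to a Hausdorff space is a
quotient map, so the boundary is the sphere, respectively the sphere with antipodal points
identified.

For the first part, the unit vectors of \<open>\<real>\<^sup>a \<times> \<int>\<^sup>b\<close> generate a lattice (\<open>lattice_of_model\<close>). For the second
part, every compactly generated locally compact abelian group has a lattice (\<open>lattice_exists\<close>):
finitely many elements generate the group up to bounded error, and they are taken one by one. In the
presence of a proper \<open>\<psi>\<close> a new element \<open>x\<close> either extends \<open>\<psi>\<close> to a proper map on \<open>\<int>\<^bsup>k+1\<^esup>\<close>, or some ball
around the image of \<open>\<psi>\<close> contains infinitely many powers of \<open>x\<close>, and then a larger one contains all of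
them (\<open>recurrent_differences\<close>, the coarse form of the fact that a locally compact monothetic group
is discrete or compact). A lattice of a closed cocompact subgroup is also one of the whole group
(\<open>common_lattice\<close>), so both groups have the boundaries \<open>sphere_in k\<close> and \<open>projective_in k\<close> for the
same \<open>k\<close>. Topology enters through compact sets being bounded in the word metric; by
Baire's theorem some power of the generating set has interior points (\<open>open_bounded_set\<close>).\<close>

section \<open>The Euclidean norm on finitely many coordinates\<close>

lemma L2_set_diff_triangle:
  "L2_set (\<lambda>i. x i - z i) A \<le> L2_set (\<lambda>i. x i - y i) A + L2_set (\<lambda>i. y i - z i) A"
  using L2_set_triangle_ineq[of "\<lambda>i. x i - y i" "\<lambda>i. y i - z i" A] by simp

lemma L2_set_minus: "L2_set (\<lambda>i. - x i) A = L2_set x A"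
  by (simp add: L2_set_def)

lemma L2_set_diff_commute: "L2_set (\<lambda>i. x i - y i) A = L2_set (\<lambda>i. y i - x i) A"
  using L2_set_minus[of "\<lambda>i. x i - y i" A] by simp

lemma L2_set_scale: "L2_set (\<lambda>i. c * x i) A = \<bar>c\<bar> * L2_set x A"
  by (simp add: L2_set_def power_mult_distrib real_sqrt_mult flip: sum_distrib_left)

lemma L2_set_reverse_triangle: "\<bar>L2_set x A - L2_set y A\<bar> \<le> L2_set (\<lambda>i. x i - y i) A"
  using L2_set_diff_triangle[of x "\<lambda>_. 0" A y] L2_set_diff_triangle[of y "\<lambda>_. 0" A x]
  by (simp add: L2_set_diff_commute[of y x])

lemma abs_le_L2_set: "finite A \<Longrightarrow> i \<in> A \<Longrightarrow> \<bar>x i\<bar> \<le> L2_set x A"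
  using member_le_L2_set[of A i "\<lambda>i. \<bar>x i\<bar>"] by (simp add: L2_set_def)

lemma L2_set_le_bound:
  fixes k :: nat
  assumes "\<And>i. i < k \<Longrightarrow> \<bar>x i\<bar> \<le> C"
  shows "L2_set x {..<k} \<le> real k * C"
proof -
  have "L2_set x {..<k} \<le> (\<Sum>i<k. \<bar>x i\<bar>)" by (rule L2_set_le_sum_abs)
  also have "\<dots> \<le> real (card {..<k}) * C" by (rule sum_bounded_above) (use assms in auto)
  finally show ?thesis by simp
qed

lemma L2_set_eq_1_iff: "L2_set x A = 1 \<longleftrightarrow> (\<Sum>i\<in>A. (x i)\<^sup>2) = 1"
  by (simp add: L2_set_def)

lemma topspace_sphere_in:
  "topspace (sphere_in k) = {u. (\<forall>i\<ge>k. u i = 0) \<and> L2_set u {..<k} = 1}"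
  by (auto simp: sphere_in_def topspace_Euclidean_space L2_set_eq_1_iff)

lemma continuous_map_L2_dist_sphere_in:
  "continuous_map (sphere_in k) euclideanreal (\<lambda>u. L2_set (\<lambda>i. u0 i - u i) {..<k})"
proof -
  have "continuous_map euclideanreal euclideanreal sqrt"
    by (simp add: continuous_on_real_sqrt)
  moreover have "continuous_map (sphere_in k) euclideanreal (\<lambda>u. \<Sum>i<k. (u0 i - u i)\<^sup>2)"
    unfolding sphere_in_def Euclidean_space_def subtopology_subtopology
    by (intro continuous_intros continuous_map_from_subtopology continuous_map_product_projection) auto
  ultimately show ?thesis
    using continuous_map_compose unfolding L2_set_def o_def by blast
qed

lemma compact_space_sphere_in: "compact_space (sphere_in k)"
proof -
  let ?X = "product_topology (\<lambda>_. euclideanreal) (UNIV :: nat set)"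
  let ?B = "PiE UNIV (\<lambda>i::nat. {-1..1::real})"
  let ?C = "{x \<in> topspace ?X. (\<Sum>i<k. (x i)\<^sup>2) \<in> {1}}"
  have "continuous_map ?X euclideanreal (\<lambda>x. \<Sum>i<k. (x i)\<^sup>2)"
    by (intro continuous_intros continuous_map_product_projection) auto
  then have C: "closedin ?X ?C"
    by (rule closedin_continuous_map_preimage) auto
  have E: "closedin ?X {x. \<forall>i\<ge>k. x i = 0}"
    using closedin_Euclidean_space[of k] by (simp add: topspace_Euclidean_space)
  have B: "compactin ?X ?B"
    by (subst compactin_PiE) auto
  have "{x. \<forall>i\<ge>k. x i = 0} \<inter> {x. (\<Sum>i<k. (x i)\<^sup>2) = 1} \<subseteq> ?B"
  proof
    fix x :: "nat \<Rightarrow> real"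
    assume x: "x \<in> {x. \<forall>i\<ge>k. x i = 0} \<inter> {x. (\<Sum>i<k. (x i)\<^sup>2) = 1}"
    have "\<bar>x i\<bar> \<le> 1" for i
      using x abs_le_L2_set[of "{..<k}" i x] L2_set_eq_1_iff[of x "{..<k}"]
      by (cases "i < k") auto
    then show "x \<in> ?B" by (auto simp: abs_le_iff minus_le_iff)
  qed
  then have "{x. \<forall>i\<ge>k. x i = 0} \<inter> {x. (\<Sum>i<k. (x i)\<^sup>2) = 1} =
      ?B \<inter> ({x. \<forall>i\<ge>k. x i = 0} \<inter> ?C)"
    by auto
  then have "compactin ?X ({x. \<forall>i\<ge>k. x i = 0} \<inter> {x. (\<Sum>i<k. (x i)\<^sup>2) = 1})"
    using closed_Int_compactin[OF closedin_Int[OF E C] B] by (simp add: Int_commute)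
  then show ?thesis
    unfolding sphere_in_def Euclidean_space_def subtopology_subtopology compact_space_subtopology
    by (rule compact_space_subtopology)
qed

text \<open>Round \<open>n u\<close> to an integer vector \<open>z\<close> for a large \<open>n\<close>. Then \<open>z / n\<close> is within \<open>k / n\<close> of \<open>u\<close>, so the norm
\<open>r\<close> of \<open>z\<close> is within \<open>k\<close> of \<open>n\<close>, and replacing \<open>n\<close> by \<open>r\<close> costs at most another \<open>k / n\<close>.\<close>

lemma rational_directions_dense:
  assumes u: "L2_set u {..<k} = 1" and "0 < e"
  obtains z :: "nat \<Rightarrow> int" and r :: real where "0 < r" "r = L2_set (\<lambda>i. of_int (z i)) {..<k}"
    "L2_set (\<lambda>i. of_int (z i) / r - u i) {..<k} < e"
proof -
  let ?nrm = "\<lambda>x. L2_set x {..<k}"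
  obtain n :: nat where n: "real n > 2 * real k + 2 * real k / e + 1"
    using reals_Archimedean2 by blast
  have "0 \<le> 2 * real k / e" using \<open>0 < e\<close> by simp
  then have n1: "real n > 2 * real k + 1" and n2: "real n > 2 * real k / e" and n0: "real n > 0"
    using n by linarith+
  define z where "z = (\<lambda>i. \<lfloor>real n * u i\<rfloor>)"
  define r where "r = ?nrm (\<lambda>i. of_int (z i))"
  have "\<bar>of_int (z i) - real n * u i\<bar> \<le> 1" for i
    unfolding z_def by linarith
  then have a: "?nrm (\<lambda>i. of_int (z i) - real n * u i) \<le> real k"
    using L2_set_le_bound[of k "\<lambda>i. of_int (z i) - real n * u i" 1] by simp
  have b: "\<bar>r - real n\<bar> \<le> real k"
    using L2_set_reverse_triangle[of "\<lambda>i. of_int (z i)" "{..<k}" "\<lambda>i. real n * u i"] a u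
    by (simp add: r_def L2_set_scale)
  then have r: "0 < r" using n1 by linarith
  have "real n * ?nrm (\<lambda>i. of_int (z i) / r - u i)
      = ?nrm (\<lambda>i. real n * (of_int (z i) / r - u i))"
    by (simp add: L2_set_scale)
  also have "\<dots> = ?nrm (\<lambda>i. real n / r * of_int (z i) - real n * u i)"
    by (simp add: algebra_simps)
  also have "\<dots> \<le> ?nrm (\<lambda>i. real n / r * of_int (z i) - of_int (z i)) + real k"
    using L2_set_diff_triangle[of "\<lambda>i. real n / r * of_int (z i)" "\<lambda>i. real n * u i" "{..<k}"
        "\<lambda>i. of_int (z i)"] a by linarith
  also have "?nrm (\<lambda>i. real n / r * of_int (z i) - of_int (z i))
      = ?nrm (\<lambda>i. (real n / r - 1) * of_int (z i))"
    by (simp add: algebra_simps)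
  also have "\<dots> = \<bar>real n / r - 1\<bar> * r"
    by (simp add: L2_set_scale r_def)
  also have "\<dots> = \<bar>real n - r\<bar>"
    using r by (simp add: abs_mult_pos' [symmetric] field_simps flip: abs_mult_pos)
  finally have "real n * ?nrm (\<lambda>i. of_int (z i) / r - u i) \<le> 2 * real k"
    using b by linarith
  also have "\<dots> < real n * e"
    using n2 \<open>0 < e\<close> by (simp add: field_simps)
  finally have "?nrm (\<lambda>i. of_int (z i) / r - u i) < e"
    using n0 by simp
  then show thesis using that r r_def by blast
qed

section \<open>Quotients of the sphere\<close>

text \<open>This identifies a boundary with a sphere or a projective space without a description of the
inverse map: only the fibres of the map from the sphere have to be known.\<close>

lemma quotient_maps_same_fibres_imp_homeomorphic:
  assumes f: "quotient_map X Y f" and g: "quotient_map X Z g"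
    and fibres: "\<And>x y. x \<in> topspace X \<Longrightarrow> y \<in> topspace X \<Longrightarrow> f x = f y \<longleftrightarrow> g x = g y"
  shows "Y homeomorphic_space Z"
proof -
  obtain h where h: "continuous_map Y Z h" "\<And>x. x \<in> topspace X \<Longrightarrow> h (f x) = g x"
    using quotient_map_lift_exists[OF f quotient_imp_continuous_map[OF g]] fibres by metis
  obtain h' where h': "continuous_map Z Y h'" "\<And>x. x \<in> topspace X \<Longrightarrow> h' (g x) = f x"
    using quotient_map_lift_exists[OF g quotient_imp_continuous_map[OF f]] fibres by metis
  have "\<And>y. y \<in> topspace Y \<Longrightarrow> h' (h y) = y" "\<And>z. z \<in> topspace Z \<Longrightarrow> h (h' z) = z"
    using h(2) h'(2) quotient_imp_surjective_map[OF f] quotient_imp_surjective_map[OF g]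
    by (metis imageE)+
  then show ?thesis
    using h(1) h'(1) by (auto simp: homeomorphic_space_def homeomorphic_maps_def)
qed

lemma topspace_quotient_topology: "topspace (quotient_topology X q) = q ` topspace X"
proof
  show "topspace (quotient_topology X q) \<subseteq> q ` topspace X"
    using openin_quotient_topology[of X q "topspace (quotient_topology X q)"] by auto
  have "openin (quotient_topology X q) (q ` topspace X)"
    by (auto simp: openin_quotient_topology intro: back_subst[of "openin X" "topspace X"])
  then show "q ` topspace X \<subseteq> topspace (quotient_topology X q)"
    by (rule openin_subset)
qed

lemma quotient_map_projective_in:
  "quotient_map (sphere_in k) (projective_in k) (\<lambda>u. {u, \<lambda>i. - u i})"
  by (auto simp: quotient_map_def projective_in_def topspace_quotient_topology
      openin_quotient_topology)

section \<open>Boundaries of spaces with a Euclidean chart\<close>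

text \<open>A chart is a quasi-isometry to \<open>\<real>\<^sup>k\<close>. Vectors are functions on \<open>nat\<close> of which only the first \<open>k\<close>
values matter. Hitting the integer vectors makes the image coarsely dense, and it also provides
orbits in all rational directions later.\<close>

locale euclidean_chart = pointed_metric_space +
  fixes k :: nat and v :: "'a \<Rightarrow> nat \<Rightarrow> real" and A :: real
  assumes A_ge_1: "1 \<le> A"
    and dist_le_chart: "\<And>x y. x \<in> M \<Longrightarrow> y \<in> M \<Longrightarrow>
      d x y \<le> A * L2_set (\<lambda>i. v x i - v y i) {..<k} + A"
    and chart_le_dist: "\<And>x y. x \<in> M \<Longrightarrow> y \<in> M \<Longrightarrow>
      L2_set (\<lambda>i. v x i - v y i) {..<k} \<le> A * d x y + A"
    and lattice_in_chart: "\<And>z :: nat \<Rightarrow> int. \<exists>x\<in>M. \<forall>i<k. v x i = of_int (z i)"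
begin

abbreviation nrm :: "(nat \<Rightarrow> real) \<Rightarrow> real" where
  "nrm x \<equiv> L2_set x {..<k}"

text \<open>The additive constant for estimates from the base point, whose chart value need not be \<open>0\<close>.\<close>

definition B :: real where "B = A + A * nrm (v p)"

lemma B_nonneg: "0 \<le> B"
  using A_ge_1 by (simp add: B_def)

lemma chart_le_base: "x \<in> M \<Longrightarrow> nrm (v x) \<le> A * d p x + B"
  using L2_set_reverse_triangle[of "v x" "{..<k}" "v p"] chart_le_dist[of x p]
    mult_right_mono[OF A_ge_1, of "nrm (v p)"]
  by (simp add: B_def commute)

lemma base_le_chart:
  assumes "x \<in> M" shows "d p x \<le> A * nrm (v x) + B"
proof -
  have "nrm (\<lambda>i. v p i - v x i) \<le> nrm (v p) + nrm (v x)"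
    using L2_set_diff_triangle[of "v p" "v x" "{..<k}" "\<lambda>_. 0"] by (simp add: L2_set_minus)
  then have "A * nrm (\<lambda>i. v p i - v x i) \<le> A * (nrm (v p) + nrm (v x))"
    using A_ge_1 by (intro mult_left_mono) auto
  then show ?thesis
    using dist_le_chart[of p x] assms by (simp add: B_def algebra_simps)
qed

lemma unboundedI:
  assumes "R \<subseteq> M" and "\<And>N :: real. \<exists>x\<in>R. N \<le> nrm (v x)"
  shows "R \<in> unbounded_sets"
proof -
  have "\<not> mbounded R"
  proof
    assume "mbounded R"
    then obtain c b where c: "R \<subseteq> mcball c b" by (auto simp: mbounded_def)
    obtain x where x: "x \<in> R" "A * (d p c + b) + B + 1 \<le> nrm (v x)"
      using assms(2) by blast
    have "x \<in> M" "c \<in> M" "d c x \<le> b" using c x by auto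
    then have "d p x \<le> d p c + b" using triangle[of p c x] by simp
    then have "A * d p x \<le> A * (d p c + b)" using A_ge_1 by (intro mult_left_mono) auto
    then show False using chart_le_base[OF \<open>x \<in> M\<close>] x by simp
  qed
  then show ?thesis using assms by (simp add: unbounded_sets_def)
qed

lemma boundedI:
  assumes "R \<subseteq> M" and "\<And>x. x \<in> R \<Longrightarrow> nrm (v x) \<le> N"
  shows "R \<notin> unbounded_sets"
proof -
  have "R \<subseteq> mcball p (A * N + B)"
  proof
    fix x assume "x \<in> R"
    then have x: "x \<in> M" "nrm (v x) \<le> N" using assms by auto
    then have "A * nrm (v x) \<le> A * N" using A_ge_1 by (intro mult_left_mono) auto
    then show "x \<in> mcball p (A * N + B)" using base_le_chart[of x] x by auto
  qed
  then show ?thesis by (auto simp: unbounded_sets_def mbounded_def)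
qed

text \<open>\<open>J\<close> is the nonnegative half-line for rays and the whole line for lines. The width \<open>k\<close> of the
  neighbourhood guarantees that every point of \<open>J u\<close> is shadowed, since every vector is within
  \<open>k\<close> of an integer vector.\<close>

definition cone :: "real set \<Rightarrow> (nat \<Rightarrow> real) \<Rightarrow> 'a set" where
  "cone J u = {x \<in> M. \<exists>t\<in>J. nrm (\<lambda>i. v x i - t * u i) \<le> real k}"

lemma cone_subset: "cone J u \<subseteq> M"
  by (auto simp: cone_def)

lemma cone_point:
  assumes "t \<in> J"
  obtains x where "x \<in> cone J u" "x \<in> M" "nrm (\<lambda>i. v x i - t * u i) \<le> real k"
proof -
  obtain x where x: "x \<in> M" "\<And>i. i < k \<Longrightarrow> v x i = of_int \<lfloor>t * u i\<rfloor>"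
    using lattice_in_chart[of "\<lambda>i. \<lfloor>t * u i\<rfloor>"] by blast
  have "\<bar>v x i - t * u i\<bar> \<le> 1" if "i < k" for i
    unfolding x(2)[OF that] by linarith
  then have "nrm (\<lambda>i. v x i - t * u i) \<le> real k"
    using L2_set_le_bound[of k "\<lambda>i. v x i - t * u i" 1] by simp
  then show thesis using that x assms by (auto simp: cone_def)
qed

lemma cone_unbounded:
  assumes u: "nrm u = 1" and J: "{0..} \<subseteq> J"
  shows "cone J u \<in> unbounded_sets"
proof (rule unboundedI[OF cone_subset])
  fix N :: real
  have "\<bar>N\<bar> + real k \<in> J" using J by auto
  then obtain x where x: "x \<in> cone J u" "nrm (\<lambda>i. v x i - (\<bar>N\<bar> + real k) * u i) \<le> real k"
    by (rule cone_point)
  have "\<bar>N\<bar> + real k - nrm (v x) \<le> nrm (\<lambda>i. v x i - (\<bar>N\<bar> + real k) * u i)"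
    using L2_set_reverse_triangle[of "v x" "{..<k}" "\<lambda>i. (\<bar>N\<bar> + real k) * u i"] u
    by (simp add: L2_set_scale)
  then show "\<exists>x\<in>cone J u. N \<le> nrm (v x)" using x by (intro bexI[of _ x]) auto
qed

text \<open>Points of the two cones with the same parameter \<open>t\<close> are at distance about
\<open>\<bar>t\<bar> * nrm (u - u')\<close>, while their distance from the base point is about \<open>\<bar>t\<bar>\<close>; each estimate
loses a factor \<open>A\<close>.\<close>

lemma s_plus_cone_le:
  assumes u: "nrm u = 1" "nrm u' = 1" and J: "{0..} \<subseteq> J"
  shows "s_plus (cone J u) (cone J u') \<le> A\<^sup>2 * nrm (\<lambda>i. u i - u' i)"
proof (rule s_plus_le)
  let ?\<delta> = "nrm (\<lambda>i. u i - u' i)"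
  let ?a = "A * (B + real k) * ?\<delta> + 2 * A * real k + A"
  show "0 \<le> A\<^sup>2 * ?\<delta>" by simp
  show "0 \<le> ?a" using A_ge_1 B_nonneg by simp
  show "cone J u' \<subseteq> enlarge (A\<^sup>2 * ?\<delta>) (cone J u) ?a"
  proof
    fix y assume "y \<in> cone J u'"
    then obtain t where y: "y \<in> M" "t \<in> J" "nrm (\<lambda>i. v y i - t * u' i) \<le> real k"
      by (auto simp: cone_def)
    obtain x where x: "x \<in> cone J u" "x \<in> M" "nrm (\<lambda>i. v x i - t * u i) \<le> real k"
      using cone_point[OF y(2)] by blast
    have "\<bar>t\<bar> \<le> nrm (v x) + real k"
      using L2_set_reverse_triangle[of "v x" "{..<k}" "\<lambda>i. t * u i"] u x(3)
      by (simp add: L2_set_scale)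
    then have t: "\<bar>t\<bar> \<le> A * d p x + B + real k" using chart_le_base[OF x(2)] by linarith
    have "nrm (\<lambda>i. t * u i - t * u' i) = \<bar>t\<bar> * ?\<delta>"
      using L2_set_scale[of t "\<lambda>i. u i - u' i" "{..<k}"] by (simp add: algebra_simps)
    also have "\<dots> \<le> (A * d p x + B + real k) * ?\<delta>"
      using t by (intro mult_right_mono) auto
    finally have "nrm (\<lambda>i. v x i - v y i) \<le> (A * d p x + B + real k) * ?\<delta> + 2 * real k"
      using L2_set_diff_triangle[of "v x" "v y" "{..<k}" "\<lambda>i. t * u i"]
        L2_set_diff_triangle[of "\<lambda>i. t * u i" "v y" "{..<k}" "\<lambda>i. t * u' i"] x(3) y(3)
      by (simp add: L2_set_diff_commute[of "\<lambda>i. t * u' i"])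
    then have "A * nrm (\<lambda>i. v x i - v y i) \<le> A * ((A * d p x + B + real k) * ?\<delta> + 2 * real k)"
      using A_ge_1 by (intro mult_left_mono) auto
    then have "d x y \<le> A\<^sup>2 * ?\<delta> * d p x + ?a"
      using dist_le_chart[OF x(2) y(1)] by (simp add: algebra_simps power2_eq_square)
    then show "y \<in> enlarge (A\<^sup>2 * ?\<delta>) (cone J u) ?a"
      using x y by (auto simp: in_enlarge)
  qed
qed

text \<open>A point of \<open>cone J u'\<close> near \<open>n u'\<close> has a point of \<open>cone J u\<close>, near \<open>t u\<close> say, at distance at most
\<open>\<alpha> * d p x + a\<close>, where \<open>\<alpha>\<close> is as small as desired and \<open>d p x\<close> grows linearly in \<open>n\<close>. Dividing by a large
\<open>n\<close> makes the additive constants disappear and leaves \<open>\<tau> = t / n\<close>.\<close>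

lemma approx_from_s_plus_cone:
  assumes u: "nrm u = 1" "nrm u' = 1" and J: "{0..} \<subseteq> J" "\<And>t r. t \<in> J \<Longrightarrow> 0 < r \<Longrightarrow> t / r \<in> J"
    and z: "s_plus (cone J u) (cone J u') = 0" and "0 < e"
  obtains \<tau> where "\<tau> \<in> J" "nrm (\<lambda>i. u' i - \<tau> * u i) \<le> e"
proof -
  \<comment> \<open>With \<open>\<alpha> \<le> 1 / 2\<close> the bound \<open>d p x \<le> d p y + \<alpha> * d p x + a\<close> can be solved for \<open>d p x\<close>; the other
    bound turns the final term \<open>2 * A\<^sup>2 * \<alpha> * n\<close> into at most \<open>(e / 2) * n\<close>.\<close>
  define c where "c = min (1 / 2) (e / (4 * A\<^sup>2))"
  have c: "0 < c" "c \<le> 1 / 2" "2 * A\<^sup>2 * c \<le> e / 2"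
  proof -
    have "c \<le> e / (4 * A\<^sup>2)" by (simp add: c_def)
    then show "2 * A\<^sup>2 * c \<le> e / 2" using A_ge_1 by (simp add: field_simps)
  qed (use A_ge_1 \<open>0 < e\<close> in \<open>auto simp: c_def\<close>)
  obtain \<alpha> a where \<alpha>: "0 \<le> \<alpha>" "\<alpha> < c" "0 \<le> a" "cone J u' \<subseteq> enlarge \<alpha> (cone J u) a"
    using s_plus_approx[OF cone_unbounded[OF u(1) J(1)] cone_unbounded[OF u(2) J(1)]] z c(1) by metis
  define K where "K = 2 * real k + A + A * a + A * \<alpha> * (2 * (A * real k + B) + 2 * a)"
  obtain n :: nat where n: "real n > max 1 (2 * K / e)"
    using reals_Archimedean2 by blast
  have n1: "real n > 0" and n2: "K / real n \<le> e / 2"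
    using n \<open>0 < e\<close> by (auto simp: field_simps)
  have "real n \<in> J" using J(1) by auto
  then obtain y where y: "y \<in> cone J u'" "y \<in> M" "nrm (\<lambda>i. v y i - real n * u' i) \<le> real k"
    by (rule cone_point)
  then obtain x where x: "x \<in> cone J u" "x \<in> M" "d x y \<le> \<alpha> * d p x + a"
    using subsetD[OF \<alpha>(4)] by (auto simp: in_enlarge)
  obtain t where t: "t \<in> J" "nrm (\<lambda>i. v x i - t * u i) \<le> real k"
    using x(1) by (auto simp: cone_def)
  have "nrm (v y) \<le> real n + real k"
    using L2_set_reverse_triangle[of "v y" "{..<k}" "\<lambda>i. real n * u' i"] u y(3)
    by (simp add: L2_set_scale)
  then have "A * nrm (v y) \<le> A * (real n + real k)" using A_ge_1 by (intro mult_left_mono) auto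
  then have dy: "d p y \<le> A * real n + (A * real k + B)"
    using base_le_chart[OF y(2)] by (simp add: algebra_simps)
  have "\<alpha> * d p x \<le> (1 / 2) * d p x"
    using \<alpha> c by (intro mult_right_mono) auto
  then have dx: "d p x \<le> 2 * (A * real n + (A * real k + B)) + 2 * a"
    using triangle[of p y x] x y dy by (simp add: commute[of y x])
  have "nrm (\<lambda>i. real n * u' i - t * u i) \<le> nrm (\<lambda>i. v y i - v x i) + 2 * real k"
    using L2_set_diff_triangle[of "\<lambda>i. real n * u' i" "\<lambda>i. t * u i" "{..<k}" "v y"]
      L2_set_diff_triangle[of "v y" "\<lambda>i. t * u i" "{..<k}" "v x"] t(2) y(3)
    by (simp add: L2_set_diff_commute[of "\<lambda>i. real n * u' i"])
  also have "\<dots> \<le> A * (\<alpha> * d p x + a) + A + 2 * real k"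
  proof -
    have "A * d x y \<le> A * (\<alpha> * d p x + a)" using x(3) A_ge_1 by (intro mult_left_mono) auto
    then show ?thesis using chart_le_dist[OF y(2) x(2)] by (simp add: commute[of y x])
  qed
  also have "\<dots> \<le> A * (\<alpha> * (2 * (A * real n + (A * real k + B)) + 2 * a) + a) + A + 2 * real k"
    using dx \<alpha> A_ge_1 by (auto intro!: mult_left_mono)
  also have "\<dots> = K + 2 * A\<^sup>2 * \<alpha> * real n"
    by (simp add: K_def algebra_simps power2_eq_square)
  also have "\<dots> \<le> K + 2 * A\<^sup>2 * c * real n"
    using \<alpha> by (intro add_left_mono mult_right_mono mult_left_mono) auto
  also have "\<dots> \<le> K + e / 2 * real n"
    using c by (intro add_left_mono mult_right_mono) auto
  finally have "nrm (\<lambda>i. real n * u' i - t * u i) \<le> K + e / 2 * real n" .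
  moreover have "real n * nrm (\<lambda>i. u' i - t / real n * u i) = nrm (\<lambda>i. real n * u' i - t * u i)"
    using n1 L2_set_scale[of "real n" "\<lambda>i. u' i - t / real n * u i" "{..<k}"]
    by (simp add: algebra_simps)
  ultimately have "real n * nrm (\<lambda>i. u' i - t / real n * u i) \<le> K + e / 2 * real n" by simp
  then have "nrm (\<lambda>i. u' i - t / real n * u i) \<le> K / real n + e / 2"
    using n1 by (simp add: field_simps)
  then have "nrm (\<lambda>i. u' i - t / real n * u i) \<le> e" using n2 by linarith
  then show thesis using that J(2)[OF t(1) n1] by blast
qed

text \<open>Approximating \<open>u'\<close> by \<open>\<tau> u\<close> forces \<open>\<bar>\<tau>\<bar>\<close> to be close to \<open>1\<close>, since both vectors have norm \<open>1\<close>. So \<open>u'\<close> is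
close to \<open>u\<close> or, if negative parameters are allowed, to \<open>- u\<close>.\<close>

lemma s_plus_cone_eq_0:
  assumes u: "nrm u = 1" "nrm u' = 1" and J: "J = {0..} \<or> J = UNIV"
    and z: "s_plus (cone J u) (cone J u') = 0"
  shows "(\<forall>i<k. u' i = u i) \<or> J = UNIV \<and> (\<forall>i<k. u' i = - u i)"
proof (rule ccontr)
  assume neg: "\<not> ?thesis"
  define \<delta> where "\<delta> = nrm (\<lambda>i. u' i - u i)"
  define \<delta>' where "\<delta>' = (if J = UNIV then nrm (\<lambda>i. u' i - (-1) * u i) else 1)"
  have pos: "0 < \<delta>" "0 < \<delta>'"
    using neg L2_set_nonneg[of "\<lambda>i. u' i - u i" "{..<k}"]
      L2_set_nonneg[of "\<lambda>i. u' i - (-1) * u i" "{..<k}"]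
    by (auto simp: \<delta>_def \<delta>'_def less_le L2_set_eq_0_iff add_eq_0_iff2)
  define e where "e = min \<delta> \<delta>' / 3"
  have e: "0 < e" "2 * e < \<delta>" "2 * e < \<delta>'" using pos by (auto simp: e_def)
  have "{0..} \<subseteq> J" "\<And>t r. t \<in> J \<Longrightarrow> 0 < r \<Longrightarrow> t / r \<in> J" using J by auto
  from approx_from_s_plus_cone[OF u this z e(1)]
  obtain \<tau> where \<tau>: "\<tau> \<in> J" "nrm (\<lambda>i. u' i - \<tau> * u i) \<le> e" by blast
  have b: "\<bar>1 - \<bar>\<tau>\<bar>\<bar> \<le> e"
    using L2_set_reverse_triangle[of u' "{..<k}" "\<lambda>i. \<tau> * u i"] \<tau>(2) u
    by (simp add: L2_set_scale)
  have near: "nrm (\<lambda>i. u' i - s * u i) \<le> e + \<bar>\<tau> - s\<bar>" for s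
    using L2_set_diff_triangle[of u' "\<lambda>i. s * u i" "{..<k}" "\<lambda>i. \<tau> * u i"] \<tau>(2) u
      L2_set_scale[of "\<tau> - s" u "{..<k}"] by (simp add: algebra_simps)
  show False
  proof (cases "0 \<le> \<tau>")
    case True
    then show False using near[of 1] b e by (simp add: \<delta>_def)
  next
    case False
    then have "J = UNIV" using J \<tau>(1) by auto
    then show False using near[of "-1"] b e False by (simp add: \<delta>'_def)
  qed
qed

text \<open>The shape of an orbit in the chart: the multiples \<open>n w\<close> of one vector, with \<open>n\<close> natural for
\<open>J = {0..}\<close> and \<open>n\<close> an integer for \<open>J = UNIV\<close>.\<close>

definition progression :: "real set \<Rightarrow> (nat \<Rightarrow> real) \<Rightarrow> 'a set \<Rightarrow> bool" where
  "progression J w R \<longleftrightarrow> R \<subseteq> M \<and>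
    (\<forall>x\<in>R. \<exists>n::int. of_int n \<in> J \<and> (\<forall>i<k. v x i = of_int n * w i)) \<and>
    (\<forall>n::int. of_int n \<in> J \<longrightarrow> (\<exists>x\<in>R. \<forall>i<k. v x i = of_int n * w i))"

lemma progression_unbounded_iff:
  assumes R: "progression J w R" and J: "{0..} \<subseteq> J"
  shows "R \<in> unbounded_sets \<longleftrightarrow> 0 < nrm w"
proof
  assume *: "R \<in> unbounded_sets"
  show "0 < nrm w"
  proof (rule ccontr)
    assume "\<not> 0 < nrm w"
    then have "nrm w = 0" using L2_set_nonneg[of w "{..<k}"] by linarith
    then have w: "w i = 0" if "i < k" for i using that by (simp add: L2_set_eq_0_iff)
    have "nrm (v x) \<le> 0" if x: "x \<in> R" for x
    proof -
      obtain n :: int where "\<forall>i<k. v x i = of_int n * w i"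
        using R x unfolding progression_def by blast
      then have "nrm (v x) = 0" using w by (intro L2_set_0') auto
      then show ?thesis by simp
    qed
    then show False using boundedI[of R 0] R * by (auto simp: progression_def)
  qed
next
  assume w: "0 < nrm w"
  show "R \<in> unbounded_sets"
  proof (rule unboundedI)
    show "R \<subseteq> M" using R by (simp add: progression_def)
    fix N :: real
    have "0 \<le> \<bar>N\<bar> / nrm w" using w by simp
    then have "(0::real) \<le> of_int \<lceil>\<bar>N\<bar> / nrm w\<rceil>" by linarith
    then have "of_int \<lceil>\<bar>N\<bar> / nrm w\<rceil> \<in> J" using J by auto
    then obtain x where x: "x \<in> R" "\<And>i. i < k \<Longrightarrow> v x i = of_int \<lceil>\<bar>N\<bar> / nrm w\<rceil> * w i"
      using R unfolding progression_def by metis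
    have "nrm (v x) = nrm (\<lambda>i. of_int \<lceil>\<bar>N\<bar> / nrm w\<rceil> * w i)"
      using x(2) by (intro L2_set_cong) auto
    also have "\<dots> = \<bar>of_int \<lceil>\<bar>N\<bar> / nrm w\<rceil>\<bar> * nrm w" by (rule L2_set_scale)
    finally have "nrm (v x) = \<bar>of_int \<lceil>\<bar>N\<bar> / nrm w\<rceil>\<bar> * nrm w" .
    moreover have "\<bar>N\<bar> / nrm w \<le> \<bar>of_int \<lceil>\<bar>N\<bar> / nrm w\<rceil>\<bar>" by linarith
    ultimately have "\<bar>N\<bar> \<le> nrm (v x)"
      using w by (simp add: pos_divide_le_eq)
    then show "\<exists>x\<in>R. N \<le> nrm (v x)" using x(1) by (intro bexI[of _ x]) auto
  qed
qed

lemma s_plus_eq_0I: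
  assumes "R \<in> unbounded_sets" "S \<in> unbounded_sets"
    and "\<And>y. y \<in> S \<Longrightarrow> \<exists>x\<in>R. nrm (\<lambda>i. v x i - v y i) \<le> b"
  shows "s_plus R S = 0"
proof (rule antisym[OF _ s_plus_nonneg[OF assms(1,2)]])
  show "s_plus R S \<le> 0"
  proof (rule s_plus_le)
    show "0 \<le> A * \<bar>b\<bar> + A" using A_ge_1 by simp
    show "S \<subseteq> enlarge 0 R (A * \<bar>b\<bar> + A)"
    proof
      fix y assume y: "y \<in> S"
      then obtain x where x: "x \<in> R" "nrm (\<lambda>i. v x i - v y i) \<le> b" using assms(3) by blast
      have M: "x \<in> M" "y \<in> M" using x y assms(1,2) by (auto simp: unbounded_sets_def)
      have "A * nrm (\<lambda>i. v x i - v y i) \<le> A * \<bar>b\<bar>"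
        using x A_ge_1 by (intro mult_left_mono) auto
      then show "y \<in> enlarge 0 R (A * \<bar>b\<bar> + A)"
        using dist_le_chart[OF M] M x by (auto simp: in_enlarge)
    qed
  qed simp
qed

text \<open>The multiples of \<open>w\<close> lie on the ray or line and leave gaps of length \<open>nrm w\<close>, so the orbit and the
cone are at finite Hausdorff distance.\<close>

lemma progression_asym_cone:
  assumes R: "progression J w R" and w: "0 < nrm w" and J: "J = {0..} \<or> J = UNIV"
  shows "(cone J (\<lambda>i. w i / nrm w), R) \<in> asym_rel"
proof -
  let ?r = "nrm w" and ?u = "\<lambda>i. w i / nrm w"
  have J0: "{0..} \<subseteq> J" using J by auto
  have u: "nrm ?u = 1" using w L2_set_scale[of "1 / ?r" w "{..<k}"] by simp
  have U: "R \<in> unbounded_sets" "cone J ?u \<in> unbounded_sets"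
    using progression_unbounded_iff[OF R J0] w cone_unbounded[OF u J0] by auto
  have "s_plus (cone J ?u) R = 0"
  proof (rule s_plus_eq_0I[OF U(2,1)])
    fix y assume "y \<in> R"
    then obtain n :: int where n: "of_int n \<in> J" "\<And>i. i < k \<Longrightarrow> v y i = of_int n * w i"
      using R unfolding progression_def by metis
    have "of_int n * ?r \<in> J" using n(1) J w by auto
    then obtain x where x: "x \<in> cone J ?u" "nrm (\<lambda>i. v x i - of_int n * ?r * ?u i) \<le> real k"
      by (rule cone_point)
    have "nrm (\<lambda>i. v x i - v y i) = nrm (\<lambda>i. v x i - of_int n * ?r * ?u i)"
      using n(2) w by (intro L2_set_cong) auto
    then show "\<exists>x\<in>cone J ?u. nrm (\<lambda>i. v x i - v y i) \<le> real k" using x by (intro bexI[of _ x]) simp_all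
  qed
  moreover have "s_plus R (cone J ?u) = 0"
  proof (rule s_plus_eq_0I[OF U])
    fix y assume "y \<in> cone J ?u"
    then obtain t where t: "t \<in> J" "nrm (\<lambda>i. v y i - t * ?u i) \<le> real k"
      by (auto simp: cone_def)
    define n where "n = \<lfloor>t / ?r\<rfloor>"
    have "of_int n \<in> J" using t(1) J w by (auto simp: n_def)
    then obtain x where x: "x \<in> R" "\<And>i. i < k \<Longrightarrow> v x i = of_int n * w i"
      using R unfolding progression_def by metis
    have "\<bar>of_int n - t / ?r\<bar> \<le> 1" unfolding n_def by linarith
    then have n: "\<bar>of_int n - t / ?r\<bar> * ?r \<le> 1 * ?r" using w by (intro mult_right_mono) auto
    have "nrm (\<lambda>i. v x i - t * ?u i) = nrm (\<lambda>i. (of_int n - t / ?r) * w i)"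
      using x(2) by (intro L2_set_cong) (auto simp: algebra_simps)
    then have "nrm (\<lambda>i. v x i - t * ?u i) \<le> ?r" using n by (simp add: L2_set_scale)
    then have "nrm (\<lambda>i. v x i - v y i) \<le> ?r + real k"
      using L2_set_diff_triangle[of "v x" "v y" "{..<k}" "\<lambda>i. t * ?u i"] t(2)
      by (simp add: L2_set_diff_commute[of "\<lambda>i. t * w i / nrm w"])
    then show "\<exists>x\<in>R. nrm (\<lambda>i. v x i - v y i) \<le> ?r + real k" using x by auto
  qed
  ultimately show ?thesis using U by (simp add: asym_rel_def s_dist_def)
qed

definition cone_class :: "real set \<Rightarrow> (nat \<Rightarrow> real) \<Rightarrow> 'a set set" where
  "cone_class J u = asym_rel `` {cone J u}"

lemma cone_class_in:
  assumes "nrm u = 1" "{0..} \<subseteq> J"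
  shows "cone_class J u \<in> asym_classes" "cone J u \<in> cone_class J u"
  using cone_unbounded[OF assms] equiv_class_self[OF equiv_asym_rel]
  by (auto simp: cone_class_def asym_classes_def quotientI)

lemma class_dist_cone_le:
  assumes u: "nrm u = 1" "nrm u' = 1" and J: "{0..} \<subseteq> J"
  shows "class_dist (cone_class J u) (cone_class J u') \<le> A * sqrt (nrm (\<lambda>i. u i - u' i))"
proof -
  have "s_dist (cone J u) (cone J u') \<le> A\<^sup>2 * nrm (\<lambda>i. u i - u' i)"
    using s_plus_cone_le[OF u J] s_plus_cone_le[OF u(2,1) J]
    by (simp add: s_dist_def L2_set_diff_commute[of u'])
  then have "t_dist (cone J u) (cone J u') \<le> sqrt (A\<^sup>2 * nrm (\<lambda>i. u i - u' i))"
    unfolding t_dist_def by (rule real_sqrt_le_mono)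
  then show ?thesis
    using class_dist_eq[OF cone_class_in[OF u(1) J] cone_class_in[OF u(2) J]] A_ge_1
    by (simp add: real_sqrt_mult)
qed

lemma class_dist_cone_less:
  assumes u: "nrm u = 1" "nrm u' = 1" and J: "{0..} \<subseteq> J" and e: "0 < e"
    and near: "nrm (\<lambda>i. u i - u' i) < (e / A)\<^sup>2"
  shows "class_dist (cone_class J u) (cone_class J u') < e"
proof -
  have "sqrt (nrm (\<lambda>i. u i - u' i)) < e / A"
    using real_sqrt_less_mono[OF near] e A_ge_1 by simp
  then have "A * sqrt (nrm (\<lambda>i. u i - u' i)) < e"
    using A_ge_1 by (simp add: field_simps)
  then show ?thesis using class_dist_cone_le[OF u J] by linarith
qed

lemma cone_class_eq_iff:
  assumes u: "u \<in> topspace (sphere_in k)" "u' \<in> topspace (sphere_in k)"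
    and J: "J = {0..} \<or> J = UNIV"
  shows "cone_class J u = cone_class J u' \<longleftrightarrow> u' = u \<or> J = UNIV \<and> u' = (\<lambda>i. - u i)"
proof
  have n: "nrm u = 1" "nrm u' = 1" and 0: "\<And>i. i \<ge> k \<Longrightarrow> u i = 0" "\<And>i. i \<ge> k \<Longrightarrow> u' i = 0"
    using u by (auto simp: topspace_sphere_in)
  have J0: "{0..} \<subseteq> J" using J by auto
  assume "cone_class J u = cone_class J u'"
  then have "(cone J u, cone J u') \<in> asym_rel"
    using eq_equiv_class_iff[OF equiv_asym_rel] cone_unbounded n J0 by (simp add: cone_class_def)
  then have "s_plus (cone J u) (cone J u') = 0"
    using s_plus_nonneg[OF cone_unbounded[OF n(1) J0] cone_unbounded[OF n(2) J0]]
    by (auto simp: asym_rel_def s_dist_def)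
  from s_plus_cone_eq_0[OF n J this]
  have "(\<forall>i. u' i = u i) \<or> J = UNIV \<and> (\<forall>i. u' i = - u i)"
    using 0 by (metis neg_equal_zero not_le minus_zero)
  then show "u' = u \<or> J = UNIV \<and> u' = (\<lambda>i. - u i)" by (auto simp: fun_eq_iff)
next
  assume "u' = u \<or> J = UNIV \<and> u' = (\<lambda>i. - u i)"
  moreover have "cone UNIV (\<lambda>i. - u i) = cone UNIV u"
  proof -
    have "(\<exists>t. nrm (\<lambda>i. f i - t * - u i) \<le> c) \<longleftrightarrow> (\<exists>t. nrm (\<lambda>i. f i - t * u i) \<le> c)" for f c
      by (metis (no_types, lifting) ext minus_mult_commute minus_minus)
    then show ?thesis by (simp add: cone_def)
  qed
  ultimately show "cone_class J u = cone_class J u'" by (auto simp: cone_class_def)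
qed

text \<open>Continuity is the estimate \<open>class_dist_cone_less\<close>. The image of the sphere is compact, hence closed,
and it contains the classes from \<open>E\<close>, hence their closure; conversely it is contained in that
closure because \<open>E\<close> realizes all integer directions.\<close>

theorem quotient_map_cone_class:
  assumes J: "J = {0..} \<or> J = UNIV"
    and E: "E \<subseteq> unbounded_sets" "\<And>R. R \<in> E \<Longrightarrow> \<exists>w. progression J w R"
    and lattice: "\<And>z :: nat \<Rightarrow> int. 0 < nrm (\<lambda>i. of_int (z i)) \<Longrightarrow>
      \<exists>R\<in>E. progression J (\<lambda>i. of_int (z i)) R"
  shows "quotient_map (sphere_in k) (boundary E) (cone_class J)"
proof -
  have J0: "{0..} \<subseteq> J" using J by auto
  let ?S = "topspace (sphere_in k)"
  have S: "nrm u = 1" if "u \<in> ?S" for u using that by (simp add: topspace_sphere_in)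
  have cont: "continuous_map (sphere_in k) class_topology (cone_class J)"
    unfolding class_topology_def classes.continuous_map_to_metric
  proof (intro ballI allI impI)
    fix u and e :: real assume u: "u \<in> ?S" and e: "0 < e"
    let ?U = "{u' \<in> ?S. nrm (\<lambda>i. u i - u' i) \<in> {..<(e / A)\<^sup>2}}"
    have "openin (sphere_in k) ?U"
      by (rule openin_continuous_map_preimage[OF continuous_map_L2_dist_sphere_in]) auto
    moreover have "u \<in> ?U" using u e A_ge_1 by (simp add: L2_set_def)
    moreover have "cone_class J u' \<in> classes.mball (cone_class J u) e" if "u' \<in> ?U" for u'
      using that u S J0 e class_dist_cone_less cone_class_in by simp
    ultimately show "\<exists>U. openin (sphere_in k) U \<and> u \<in> U \<and>
        (\<forall>u'\<in>U. cone_class J u' \<in> classes.mball (cone_class J u) e)" by blast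
  qed
  have direction: "\<exists>u\<in>?S. asym_rel `` {R} = cone_class J u \<and> (\<forall>i<k. u i = w i / nrm w)"
    if R: "progression J w R" "0 < nrm w" for R w
  proof -
    \<comment> \<open>Points of the sphere vanish outside the first \<open>k\<close> coordinates, which the chart leaves open.\<close>
    define u where "u = (\<lambda>i. if i < k then w i / nrm w else 0)"
    have "nrm u = nrm (\<lambda>i. 1 / nrm w * w i)" by (rule L2_set_cong) (auto simp: u_def)
    also have "\<dots> = 1" using R(2) by (simp only: L2_set_scale) simp
    finally have "u \<in> ?S" by (simp add: topspace_sphere_in u_def)
    moreover have "cone J u = cone J (\<lambda>i. w i / nrm w)"
    proof -
      have "nrm (\<lambda>i. f i - t * u i) = nrm (\<lambda>i. f i - t * (w i / nrm w))" for f t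
        by (rule L2_set_cong) (auto simp: u_def)
      then show ?thesis by (simp add: cone_def)
    qed
    then have "asym_rel `` {R} = cone_class J u"
      using equiv_class_eq[OF equiv_asym_rel progression_asym_cone[OF R J]]
      by (simp add: cone_class_def)
    ultimately show ?thesis by (auto simp: u_def)
  qed
  have "compactin class_topology (cone_class J ` ?S)"
    using image_compactin[OF _ cont] compact_space_sphere_in by (auto simp: compact_space_def)
  then have "closedin class_topology (cone_class J ` ?S)"
    using classes.Hausdorff_space_mtopology by (auto simp: class_topology_def intro: compactin_imp_closedin)
  moreover have "E // asym_rel \<subseteq> cone_class J ` ?S"
  proof
    fix X assume "X \<in> E // asym_rel"
    then obtain R where R: "R \<in> E" "X = asym_rel `` {R}" by (auto simp: quotient_def)
    then obtain w where w: "progression J w R" using E(2) by blast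
    then have "0 < nrm w" using progression_unbounded_iff[OF w J0] E(1) R by auto
    then show "X \<in> cone_class J ` ?S" using direction[OF w] R(2) by auto
  qed
  ultimately have "class_topology closure_of (E // asym_rel) \<subseteq> cone_class J ` ?S"
    by (rule closure_of_minimal[rotated])
  moreover have "cone_class J ` ?S \<subseteq> class_topology closure_of (E // asym_rel)"
  proof
    fix X assume "X \<in> cone_class J ` ?S"
    then obtain u where u: "u \<in> ?S" "X = cone_class J u" by auto
    have "\<exists>Y\<in>E // asym_rel. Y \<in> classes.mball X e" if e: "0 < e" for e
    proof -
      have "0 < (e / A)\<^sup>2" using e A_ge_1 by simp
      from rational_directions_dense[OF S[OF u(1)] this]
      obtain z :: "nat \<Rightarrow> int" and r :: real where z: "0 < r" "r = nrm (\<lambda>i. of_int (z i))"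
        "nrm (\<lambda>i. of_int (z i) / r - u i) < (e / A)\<^sup>2" by metis
      obtain R where R: "R \<in> E" "progression J (\<lambda>i. of_int (z i)) R"
        using lattice[of z] z by auto
      obtain u' where u': "u' \<in> ?S" "asym_rel `` {R} = cone_class J u'"
        "\<And>i. i < k \<Longrightarrow> u' i = of_int (z i) / r"
        using direction[OF R(2)] z by auto
      have "nrm (\<lambda>i. u' i - u i) = nrm (\<lambda>i. of_int (z i) / r - u i)"
        using u'(3) by (intro L2_set_cong) auto
      then have "nrm (\<lambda>i. u i - u' i) < (e / A)\<^sup>2"
        using z(3) by (simp add: L2_set_diff_commute[of u])
      then have "cone_class J u' \<in> classes.mball X e"
        using class_dist_cone_less[OF S[OF u(1)] S[OF u'(1)] J0 e] cone_class_in J0 S u u'(1)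
        by simp
      then show ?thesis using u'(2) quotientI[OF R(1)] by metis
    qed
    then show "X \<in> class_topology closure_of (E // asym_rel)"
      using u S J0 cone_class_in by (simp add: class_topology_def classes.metric_closure_of)
  qed
  ultimately have image: "cone_class J ` ?S = class_topology closure_of (E // asym_rel)" by blast
  show ?thesis
  proof (rule continuous_imp_quotient_map[OF _ compact_space_sphere_in])
    show "continuous_map (sphere_in k) (boundary E) (cone_class J)"
      using cont image unfolding boundary_def continuous_map_in_subtopology by blast
    show "Hausdorff_space (boundary E)"
      unfolding boundary_def class_topology_def
      by (intro Hausdorff_space_subtopology classes.Hausdorff_space_mtopology)
    show "cone_class J ` ?S = topspace (boundary E)"
      using image closure_of_subset_topspace[of class_topology "E // asym_rel"]
      by (auto simp: boundary_def)
  qed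
qed

theorem boundary_homeomorphic_sphere:
  assumes "E \<subseteq> unbounded_sets" "\<And>R. R \<in> E \<Longrightarrow> \<exists>w. progression {0..} w R"
    and "\<And>z :: nat \<Rightarrow> int. 0 < nrm (\<lambda>i. of_int (z i)) \<Longrightarrow>
      \<exists>R\<in>E. progression {0..} (\<lambda>i. of_int (z i)) R"
  shows "boundary E homeomorphic_space sphere_in k"
proof (rule quotient_maps_same_fibres_imp_homeomorphic)
  show "quotient_map (sphere_in k) (boundary E) (cone_class {0..})"
    by (rule quotient_map_cone_class) (use assms in auto)
  show "quotient_map (sphere_in k) (sphere_in k) (\<lambda>u. u)"
    by (simp add: quotient_map_def Collect_conj_eq[symmetric] Int_absorb1 openin_subset
        flip: Int_def Collect_mem_eq)
  have "(-1::real) \<notin> {0..}" by simp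
  then have "{0..} \<noteq> (UNIV :: real set)" by blast
  then show "cone_class {0..} u = cone_class {0..} u' \<longleftrightarrow> u = u'"
    if "u \<in> topspace (sphere_in k)" "u' \<in> topspace (sphere_in k)" for u u'
    using cone_class_eq_iff[OF that, of "{0..}"] by auto
qed

theorem boundary_homeomorphic_projective:
  assumes "E \<subseteq> unbounded_sets" "\<And>R. R \<in> E \<Longrightarrow> \<exists>w. progression UNIV w R"
    and "\<And>z :: nat \<Rightarrow> int. 0 < nrm (\<lambda>i. of_int (z i)) \<Longrightarrow>
      \<exists>R\<in>E. progression UNIV (\<lambda>i. of_int (z i)) R"
  shows "boundary E homeomorphic_space projective_in k"
proof (rule quotient_maps_same_fibres_imp_homeomorphic[OF _ quotient_map_projective_in])
  show "quotient_map (sphere_in k) (boundary E) (cone_class UNIV)"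
    by (rule quotient_map_cone_class) (use assms in auto)
  show "cone_class UNIV u = cone_class UNIV u' \<longleftrightarrow> {u, \<lambda>i. - u i} = {u', \<lambda>i. - u' i}"
    if "u \<in> topspace (sphere_in k)" "u' \<in> topspace (sphere_in k)" for u u'
    using cone_class_eq_iff[OF that, of UNIV] by (auto simp: doubleton_eq_iff fun_eq_iff)
qed

end

section \<open>Lattice points and additive functions on abelian groups\<close>

text \<open>The image of an integer vector under the homomorphism that maps the unit vectors to
\<open>g 0, \<dots>, g (k - 1)\<close>. A recursion on \<open>k\<close>, with vectors being functions on all of \<open>nat\<close>, makes adding one
generator a definitional step.\<close>

primrec lattice_point ::
    "('a, 'm) monoid_scheme \<Rightarrow> (nat \<Rightarrow> 'a) \<Rightarrow> nat \<Rightarrow> (nat \<Rightarrow> int) \<Rightarrow> 'a" where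
  "lattice_point G g 0 z = \<one>\<^bsub>G\<^esub>"
| "lattice_point G g (Suc k) z = lattice_point G g k z \<otimes>\<^bsub>G\<^esub> g k [^]\<^bsub>G\<^esub> z k"

lemma lattice_point_cong:
  "(\<And>i. i < k \<Longrightarrow> g i = g' i) \<Longrightarrow> (\<And>i. i < k \<Longrightarrow> z i = z' i) \<Longrightarrow>
    lattice_point G g k z = lattice_point G g' k z'"
  by (induction k) auto

context comm_group
begin

lemma lattice_point_closed [simp]:
  "range g \<subseteq> carrier G \<Longrightarrow> lattice_point G g k z \<in> carrier G"
  by (induction k) (auto simp: image_subset_iff)

lemma lattice_point_add:
  "range g \<subseteq> carrier G \<Longrightarrow>
    lattice_point G g k (\<lambda>i. z i + w i) = lattice_point G g k z \<otimes> lattice_point G g k w"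
  by (induction k) (auto simp: image_subset_iff int_pow_mult m_ac)

lemma lattice_point_zero: "range g \<subseteq> carrier G \<Longrightarrow> lattice_point G g k (\<lambda>_. 0) = \<one>"
  by (induction k) auto

lemma lattice_point_minus:
  assumes "range g \<subseteq> carrier G"
  shows "lattice_point G g k (\<lambda>i. - z i) = inv (lattice_point G g k z)"
  using lattice_point_add[OF assms, of k "\<lambda>i. - z i" z] lattice_point_zero[OF assms, of k] assms
  by (intro inv_equality[symmetric]) auto

lemma lattice_point_diff:
  assumes "range g \<subseteq> carrier G"
  shows "lattice_point G g k (\<lambda>i. z i - w i)
    = inv (lattice_point G g k w) \<otimes> lattice_point G g k z"
  using lattice_point_add[OF assms, of k z "\<lambda>i. - w i"] lattice_point_minus[OF assms, of k w] assms
  by (simp add: m_comm)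

lemma lattice_point_pow:
  assumes "range g \<subseteq> carrier G"
  shows "lattice_point G g k z [^] (n :: nat) = lattice_point G g k (\<lambda>i. int n * z i)"
  using assms
  by (induction n) (simp_all add: lattice_point_zero algebra_simps lattice_point_add m_comm)

lemma lattice_point_unit:
  assumes "range g \<subseteq> carrier G" "j < k"
  shows "lattice_point G g k (\<lambda>i. if i = j then 1 else 0) = g j"
  using assms(2)
proof (induction k)
  case (Suc k)
  have *: "g i \<in> carrier G" for i using assms(1) by auto
  show ?case
  proof (cases "j = k")
    case True
    have "lattice_point G g k (\<lambda>i. if i = j then 1 else 0) = lattice_point G g k (\<lambda>_. 0)"
      using True by (intro lattice_point_cong) auto
    then show ?thesis using True * assms(1) by (simp add: lattice_point_zero)
  next
    case False
    then show ?thesis using Suc * by simp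
  qed
qed simp

lemma additive_one:
  fixes h :: "'a \<Rightarrow> real"
  assumes "\<And>x y. x \<in> carrier G \<Longrightarrow> y \<in> carrier G \<Longrightarrow> h (x \<otimes> y) = h x + h y"
  shows "h \<one> = 0"
  using assms[of \<one> \<one>] by simp

lemma additive_inv:
  fixes h :: "'a \<Rightarrow> real"
  assumes "\<And>x y. x \<in> carrier G \<Longrightarrow> y \<in> carrier G \<Longrightarrow> h (x \<otimes> y) = h x + h y"
    and "x \<in> carrier G"
  shows "h (inv x) = - h x"
  using assms(1)[of "inv x" x] additive_one[of h] assms by simp

lemma additive_int_pow:
  fixes h :: "'a \<Rightarrow> real"
  assumes h: "\<And>x y. x \<in> carrier G \<Longrightarrow> y \<in> carrier G \<Longrightarrow> h (x \<otimes> y) = h x + h y"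
    and x: "x \<in> carrier G"
  shows "h (x [^] (n :: int)) = of_int n * h x"
proof -
  have nat: "h (x [^] (m :: nat)) = of_nat m * h x" for m
    using additive_one[of h] h x by (induction m) (auto simp: algebra_simps)
  show ?thesis
  proof (cases n)
    case (nonneg m)
    then show ?thesis using nat[of m] by (simp add: int_pow_int)
  next
    case (neg m)
    then show ?thesis
      using nat[of "Suc m"] additive_inv[OF h, of "x [^] Suc m"] x
      by (simp add: int_pow_neg_int del: of_nat_Suc nat_pow_Suc)
  qed
qed

lemma additive_lattice_point:
  fixes h :: "'a \<Rightarrow> real"
  assumes h: "\<And>x y. x \<in> carrier G \<Longrightarrow> y \<in> carrier G \<Longrightarrow> h (x \<otimes> y) = h x + h y"
    and g: "range g \<subseteq> carrier G"
  shows "h (lattice_point G g k z) = (\<Sum>i<k. of_int (z i) * h (g i))"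
proof (induction k)
  case 0
  show ?case using additive_one[OF h] by simp
next
  case (Suc k)
  then show ?case using h g additive_int_pow[OF h] by (auto simp: image_subset_iff)
qed

end

section \<open>Recurrent exponents and almost additive sequences\<close>

text \<open>The powers of one group element, seen modulo a subgroup: \<open>P r\<close> is the set of exponents for which
the power lies in the ball of radius \<open>r\<close>, and \<open>K\<close> comes from covering a ball by finitely many balls
of a fixed radius. If infinitely many powers lie in one ball, then arbitrarily large exponents lie in
\<open>P c\<close>. Subtracting such an exponent turns the differences from \<open>K\<close> into positive ones, so from each element
of \<open>P (2 c)\<close> one can descend to another one by a step of bounded size. As \<open>P (2 c)\<close> is unbounded above,
it has bounded gaps.\<close>

lemma recurrent_differences:
  fixes P :: "nat \<Rightarrow> int set"
  assumes add: "\<And>r s m n. m \<in> P r \<Longrightarrow> n \<in> P s \<Longrightarrow> m + n \<in> P (r + s)"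
    and neg: "\<And>r n. n \<in> P r \<Longrightarrow> - n \<in> P r"
    and mono: "\<And>r s. r \<le> s \<Longrightarrow> P r \<subseteq> P s"
    and all: "\<And>n. \<exists>r. n \<in> P r"
    and cover: "\<And>r. \<exists>K. finite K \<and> (\<forall>n\<in>P r. \<exists>\<kappa>\<in>K. n - \<kappa> \<in> P c)"
    and inf: "infinite (P r)"
  shows "\<exists>s. P s = UNIV"
proof -
  have inf_c: "infinite (P c)"
  proof
    assume fin: "finite (P c)"
    obtain K where K: "finite K" "\<forall>n\<in>P r. \<exists>\<kappa>\<in>K. n - \<kappa> \<in> P c" using cover by blast
    have "P r \<subseteq> (\<lambda>(\<kappa>, n). \<kappa> + n) ` (K \<times> P c)"
    proof
      fix n assume "n \<in> P r"
      then obtain \<kappa> where "\<kappa> \<in> K" "n - \<kappa> \<in> P c" using K(2) by blast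
      then have "(\<kappa>, n - \<kappa>) \<in> K \<times> P c" by simp
      then show "n \<in> (\<lambda>(\<kappa>, n). \<kappa> + n) ` (K \<times> P c)" by (force simp: image_iff)
    qed
    then show False using finite_subset inf fin K(1) by blast
  qed
  have large: "\<exists>q\<in>P c. b < q" for b
  proof (rule ccontr)
    assume "\<not> ?thesis"
    then have "P c \<subseteq> {-b..b}" using neg[of _ c] by (force simp: not_less)
    then show False using inf_c finite_subset by blast
  qed
  obtain K where K: "finite K" "\<forall>n\<in>P (c + c). \<exists>\<kappa>\<in>K. n - \<kappa> \<in> P c" using cover by blast
  define b where "b = Max (insert 0 (abs ` K))"
  have b: "\<bar>\<kappa>\<bar> \<le> b" if "\<kappa> \<in> K" for \<kappa> using that K(1) by (auto simp: b_def)
  obtain q where q: "q \<in> P c" "b < q" using large by blast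
  have descend: "\<exists>\<mu>. 0 < \<mu> \<and> \<mu> \<le> b + q \<and> n - \<mu> \<in> P (c + c)" if n: "n \<in> P (c + c)" for n
  proof -
    obtain \<kappa> where \<kappa>: "\<kappa> \<in> K" "n - \<kappa> \<in> P c" using K(2) n by blast
    have "n - \<kappa> + - q \<in> P (c + c)" using add[OF \<kappa>(2) neg[OF q(1)]] .
    then show ?thesis using b[OF \<kappa>(1)] q(2) by (intro exI[of _ "\<kappa> + q"]) (auto simp: algebra_simps)
  qed
  obtain \<rho> where \<rho>: "\<And>n. n \<in> P (\<rho> n)" using all by metis
  define s where "s = Max (insert 0 (\<rho> ` {-(b + q)..0}))"
  have s: "n \<in> P s" if "- (b + q) \<le> n" "n \<le> 0" for n
  proof -
    have "\<rho> n \<le> s" using that by (auto simp: s_def)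
    then show ?thesis using \<rho>[of n] mono by blast
  qed
  have "j \<in> P (c + c + s)" for j
  proof -
    obtain q' where q': "q' \<in> P c" "j < q'" using large by blast
    have "q' \<in> P (c + c)" using q'(1) mono[of c "c + c"] by auto
    then have ex: "\<exists>m. j + int m \<in> P (c + c)"
      using q'(2) by (intro exI[of _ "nat (q' - j)"]) auto
    \<comment> \<open>From the first element \<open>j + m\<close> of \<open>P (2 c)\<close> that is not below \<open>j\<close> the next step down passes \<open>j\<close>,
      so \<open>m\<close> is bounded.\<close>
    define m where "m = (LEAST m. j + int m \<in> P (c + c))"
    have m: "j + int m \<in> P (c + c)" unfolding m_def by (rule LeastI_ex[OF ex])
    obtain \<mu> where \<mu>: "0 < \<mu>" "\<mu> \<le> b + q" "j + int m - \<mu> \<in> P (c + c)"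
      using descend[OF m] by blast
    have "int m < \<mu>"
    proof (rule ccontr)
      assume "\<not> int m < \<mu>"
      then have "j + int (m - nat \<mu>) \<in> P (c + c)" using \<mu>(1,3) by (simp add: of_nat_diff algebra_simps nat_le_iff)
      then have "m \<le> m - nat \<mu>" unfolding m_def by (rule Least_le)
      then show False using \<mu>(1) \<open>\<not> int m < \<mu>\<close> by linarith
    qed
    then have "- int m \<in> P s" using \<mu>(2) by (intro s) auto
    from add[OF m this] show ?thesis by simp
  qed
  then show ?thesis by blast
qed

text \<open>Comparing \<open>a (m n)\<close> with both \<open>m * a n\<close> and \<open>n * a m\<close> shows that \<open>a n / n\<close> is a Cauchy sequence, with
the rate \<open>E / n\<close> to its limit \<open>L\<close>.\<close>

lemma quasi_additive_sequence_linear: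
  fixes a :: "nat \<Rightarrow> real"
  assumes quasi: "\<And>m n. \<bar>a (m + n) - a m - a n\<bar> \<le> E"
  shows "\<exists>L. \<forall>n. \<bar>a n - real n * L\<bar> \<le> E"
proof -
  have mult: "\<bar>a (Suc m * n) - real (Suc m) * a n\<bar> \<le> real (Suc m) * E" for m n
  proof (induction m)
    case 0
    show ?case using quasi[of 0 0] by simp
  next
    case (Suc m)
    then show ?case using quasi[of n "Suc m * n"] by (simp add: algebra_simps)
  qed
  have close: "\<bar>a n / real n - a m / real m\<bar> \<le> E / real n + E / real m" if "0 < m" "0 < n" for m n
  proof -
    have 1: "\<bar>a (m * n) - real m * a n\<bar> \<le> real m * E" and 2: "\<bar>a (m * n) - real n * a m\<bar> \<le> real n * E"
      using mult[of "m - 1" n] mult[of "n - 1" m] that by (simp_all add: mult.commute[of n m])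
    have "\<bar>real m * a n - real n * a m\<bar> \<le> real m * E + real n * E" using 1 2 by linarith
    moreover have "a n / real n - a m / real m = (real m * a n - real n * a m) / (real m * real n)"
      and "E / real n + E / real m = (real m * E + real n * E) / (real m * real n)"
      using that by (simp_all add: field_simps)
    ultimately show ?thesis using that by (simp add: abs_divide divide_right_mono)
  qed
  have E0: "0 \<le> E" using quasi[of 0 0] by linarith
  have "Cauchy (\<lambda>n. a n / real n)"
  proof (rule metric_CauchyI)
    fix e :: real assume "0 < e"
    obtain N :: nat where N: "real N > max 1 (2 * E / e)" using reals_Archimedean2 by blast
    have bound: "E / real n < e / 2" if "N \<le> n" for n
    proof -
      have "2 * E / e < real n" using N that by simp
      then show ?thesis using N that \<open>0 < e\<close> by (simp add: field_simps)
    qed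
    show "\<exists>M. \<forall>m\<ge>M. \<forall>n\<ge>M. dist (a m / real m) (a n / real n) < e"
    proof (intro exI[of _ N] allI impI)
      fix m n assume mn: "N \<le> m" "N \<le> n"
      then have "0 < m" "0 < n" using N by auto
      then show "dist (a m / real m) (a n / real n) < e"
        using close[OF \<open>0 < n\<close> \<open>0 < m\<close>] bound[OF mn(1)] bound[OF mn(2)]
        unfolding dist_real_def by linarith
    qed
  qed
  then obtain L where L: "(\<lambda>n. a n / real n) \<longlonglongrightarrow> L"
    using Cauchy_convergent convergent_def by blast
  have "\<bar>a n - real n * L\<bar> \<le> E" if n: "0 < n" for n
  proof -
    have "(\<lambda>m. \<bar>a n / real n - a m / real m\<bar>) \<longlonglongrightarrow> \<bar>a n / real n - L\<bar>"
      by (intro tendsto_intros L)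
    moreover have "(\<lambda>m. E / real n + E / real m) \<longlonglongrightarrow> E / real n + 0"
      by (intro tendsto_intros lim_const_over_n)
    ultimately have "\<bar>a n / real n - L\<bar> \<le> E / real n + 0"
      using close[OF _ n] by (intro LIMSEQ_le) (auto intro!: exI[of _ 1])
    moreover have "\<bar>a n - real n * L\<bar> = real n * \<bar>a n / real n - L\<bar>"
      using n by (simp add: abs_mult[of "real n", simplified, symmetric] algebra_simps)
    ultimately show ?thesis using n by (simp add: field_simps)
  qed
  moreover have "\<bar>a 0 - real 0 * L\<bar> \<le> E" using quasi[of 0 0] by simp
  ultimately show ?thesis by (metis gr0I)
qed

section \<open>Lattices and their charts\<close>

text \<open>The properties of a word length that matter; \<open>len_split\<close> says that an element of length \<open>n\<close> is
reached from the identity in \<open>n\<close> steps of length at most \<open>1\<close>.\<close>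

locale length_group = comm_group +
  fixes len :: "'a \<Rightarrow> nat"
  assumes len_one: "len \<one> = 0"
    and len_mult: "\<And>x y. x \<in> carrier G \<Longrightarrow> y \<in> carrier G \<Longrightarrow> len (x \<otimes> y) \<le> len x + len y"
    and len_inv: "\<And>x. x \<in> carrier G \<Longrightarrow> len (inv x) = len x"
    and len_split: "\<And>x n. x \<in> carrier G \<Longrightarrow> len x = Suc n \<Longrightarrow>
      \<exists>s\<in>carrier G. \<exists>y\<in>carrier G. x = s \<otimes> y \<and> len s \<le> 1 \<and> len y \<le> n"
begin

lemma len_pow: "x \<in> carrier G \<Longrightarrow> len (x [^] (n :: nat)) \<le> n * len x"
proof (induction n)
  case (Suc n)
  then show ?case using len_mult[of "x [^] n" x] by simp
qed (simp add: len_one)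

lemma len_int_pow: "x \<in> carrier G \<Longrightarrow> len (x [^] (n :: int)) \<le> nat \<bar>n\<bar> * len x"
proof (cases n)
  case (nonneg i)
  then show "x \<in> carrier G \<Longrightarrow> ?thesis" using len_pow[of x i] by (simp add: int_pow_int)
next
  case (neg i)
  then show "x \<in> carrier G \<Longrightarrow> ?thesis" using len_pow[of x "Suc i"]
    by (simp add: int_pow_neg_int len_inv del: of_nat_Suc nat_pow_Suc)
qed

lemma len_cancel:
  assumes "x \<in> carrier G" "y \<in> carrier G"
  shows "len x \<le> len (x \<otimes> y) + len y"
  using len_mult[of "x \<otimes> y" "inv y"] assms by (simp add: m_assoc len_inv)

lemma len_lattice_point:
  assumes "range g \<subseteq> carrier G"
  shows "len (lattice_point G g k z) \<le> (\<Sum>i<k. nat \<bar>z i\<bar> * len (g i))"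
proof (induction k)
  case (Suc k)
  have "g k \<in> carrier G" using assms by auto
  then show ?case
    using Suc len_mult[of "lattice_point G g k z" "g k [^] z k"] len_int_pow[of "g k" "z k"] assms
    by simp
qed (simp add: len_one)

text \<open>Only the first \<open>k\<close> coordinates influence a lattice point, so the usual condition of finitely many
lattice points in a ball becomes a bound on these coordinates.\<close>

definition proper :: "(nat \<Rightarrow> 'a) \<Rightarrow> nat \<Rightarrow> bool" where
  "proper g k \<longleftrightarrow> range g \<subseteq> carrier G \<and>
    (\<forall>r. \<exists>C. \<forall>z. len (lattice_point G g k z) \<le> r \<longrightarrow> (\<forall>i<k. \<bar>z i\<bar> \<le> C))"

definition lattice :: "(nat \<Rightarrow> 'a) \<Rightarrow> nat \<Rightarrow> bool" where
  "lattice g k \<longleftrightarrow> proper g k \<and>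
    (\<exists>D. \<forall>x\<in>carrier G. \<exists>z. len (inv (lattice_point G g k z) \<otimes> x) \<le> D)"

text \<open>Choose for each \<open>x\<close> an integer vector \<open>f x\<close> whose lattice point is within \<open>D\<close> of \<open>x\<close>. By properness two
vectors with nearby lattice points differ by at most \<open>E\<close> in each coordinate (\<open>close\<close>); this single
fact shows that \<open>f\<close> is additive up to \<open>E\<close> (\<open>quasi\<close>) and that \<open>f x\<close> grows at most linearly in the length
of \<open>x\<close>, by following a shortest path from the identity to \<open>x\<close> and correcting the lattice point after
every step (\<open>approx\<close>). The chart is the homogenization \<open>v x = lim f (x\<^sup>n) / n\<close>, which is within \<open>E\<close> of
\<open>f x\<close>, and a bounded error in the additivity of a homogeneous map must vanish.\<close>

theorem lattice_chart:
  assumes "lattice g k"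
  obtains v :: "'a \<Rightarrow> nat \<Rightarrow> real" and A :: real where "1 \<le> A"
    "\<And>x y i. x \<in> carrier G \<Longrightarrow> y \<in> carrier G \<Longrightarrow> i < k \<Longrightarrow> v (x \<otimes> y) i = v x i + v y i"
    "\<And>x. x \<in> carrier G \<Longrightarrow> real (len x) \<le> A * L2_set (v x) {..<k} + A"
    "\<And>x. x \<in> carrier G \<Longrightarrow> L2_set (v x) {..<k} \<le> A * real (len x) + A"
    "\<And>z i. i < k \<Longrightarrow> v (lattice_point G g k z) i = of_int (z i)"
proof -
  let ?h = "lattice_point G g k"
  have gc: "range g \<subseteq> carrier G" using assms by (simp add: lattice_def proper_def)
  note h = lattice_point_closed[OF gc]
  obtain D where "\<forall>x\<in>carrier G. \<exists>z. len (inv (?h z) \<otimes> x) \<le> D"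
    using assms unfolding lattice_def by blast
  then obtain f where f: "\<And>x. x \<in> carrier G \<Longrightarrow> len (inv (?h (f x)) \<otimes> x) \<le> D"
    by metis
  \<comment> \<open>This radius covers both comparisons below: a lattice point known up to \<open>D\<close> is compared with one
    known up to \<open>2 D\<close> in \<open>quasi\<close>, and with one known up to \<open>D + 1\<close> in \<open>approx\<close>.\<close>
  obtain E0 where E0: "\<And>z i. len (?h z) \<le> 3 * D + 1 \<Longrightarrow> i < k \<Longrightarrow> \<bar>z i\<bar> \<le> E0"
    using assms unfolding lattice_def proper_def by metis
  define E where "E = real_of_int (max E0 0)"
  have E: "0 \<le> E" by (simp add: E_def)
  have close: "\<bar>real_of_int (z i) - of_int (w i)\<bar> \<le> E"
    if x: "x \<in> carrier G" and r: "len (inv (?h z) \<otimes> x) \<le> r" and s: "len (inv (?h w) \<otimes> x) \<le> s"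
      and "r + s \<le> 3 * D + 1" "i < k" for x z w r s i
  proof -
    have "?h (\<lambda>i. z i - w i) = (inv (?h w) \<otimes> x) \<otimes> inv (inv (?h z) \<otimes> x)"
    proof -
      have "inv (?h w) \<otimes> x \<otimes> (?h z \<otimes> y) = inv (?h w) \<otimes> ?h z \<otimes> (x \<otimes> y)" if "y \<in> carrier G" for y
        using x h that by (simp add: m_ac)
      from this[of "inv x"] have "(inv (?h w) \<otimes> x) \<otimes> inv (inv (?h z) \<otimes> x) = inv (?h w) \<otimes> ?h z \<otimes> (x \<otimes> inv x)"
        using x h by (simp add: inv_mult)
      then show ?thesis using x h by (simp add: lattice_point_diff[OF gc])
    qed
    then have "len (?h (\<lambda>i. z i - w i)) \<le> s + r"
      using len_mult[of "inv (?h w) \<otimes> x" "inv (inv (?h z) \<otimes> x)"] len_inv[of "inv (?h z) \<otimes> x"] r s x h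
      by simp
    then have "\<bar>z i - w i\<bar> \<le> E0" using E0[of "\<lambda>i. z i - w i" i] that by simp
    then have "real_of_int \<bar>z i - w i\<bar> \<le> E" unfolding E_def by (simp only: of_int_le_iff)
    then show ?thesis by simp
  qed
  have quasi: "\<bar>real_of_int (f (x \<otimes> y) i) - of_int (f x i) - of_int (f y i)\<bar> \<le> E"
    if xy: "x \<in> carrier G" "y \<in> carrier G" and i: "i < k" for x y i
  proof -
    have "inv (?h (\<lambda>i. f x i + f y i)) \<otimes> (x \<otimes> y) = (inv (?h (f x)) \<otimes> x) \<otimes> (inv (?h (f y)) \<otimes> y)"
      using xy h by (simp add: lattice_point_add[OF gc] inv_mult m_ac)
    then have "len (inv (?h (\<lambda>i. f x i + f y i)) \<otimes> (x \<otimes> y)) \<le> D + D"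
      using len_mult[of "inv (?h (f x)) \<otimes> x" "inv (?h (f y)) \<otimes> y"] f[OF xy(1)] f[OF xy(2)] xy h
      by simp
    from close[OF _ f this _ i] show ?thesis using xy by simp
  qed
  have approx: "\<exists>w. len (inv (?h w) \<otimes> x) \<le> D \<and> (\<forall>i<k. \<bar>real_of_int (w i)\<bar> \<le> E * real n)"
    if "x \<in> carrier G" "len x \<le> n" for x n
    using that
  proof (induction n arbitrary: x)
    case 0
    then show ?case by (intro exI[of _ "\<lambda>_. 0"]) (simp add: lattice_point_zero[OF gc])
  next
    case (Suc n)
    show ?case
    proof (cases "len x \<le> n")
      case True
      then obtain w where w: "len (inv (?h w) \<otimes> x) \<le> D" "\<And>i. i < k \<Longrightarrow> \<bar>real_of_int (w i)\<bar> \<le> E * real n"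
        using Suc by blast
      have "E * real n \<le> E * real (Suc n)" using E by (intro mult_left_mono) auto
      then show ?thesis using w by (meson order_trans)
    next
      case False
      then have "len x = Suc n" using Suc.prems by simp
      then obtain s y where sy: "s \<in> carrier G" "y \<in> carrier G" "x = s \<otimes> y" "len s \<le> 1" "len y \<le> n"
        using len_split Suc.prems(1) by blast
      then obtain w where w: "len (inv (?h w) \<otimes> y) \<le> D" "\<And>i. i < k \<Longrightarrow> \<bar>real_of_int (w i)\<bar> \<le> E * real n"
        using Suc.IH by blast
      define b where "b = inv (?h w) \<otimes> x"
      have b: "b \<in> carrier G" using Suc.prems(1) h by (simp add: b_def)
      have "b = s \<otimes> (inv (?h w) \<otimes> y)" using h sy by (simp add: b_def m_ac)
      then have "len b \<le> D + 1"
        using len_mult[of s "inv (?h w) \<otimes> y"] w(1) sy h by simp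
      then have b0: "len (inv (?h (\<lambda>_. 0)) \<otimes> b) \<le> D + 1" using b by (simp add: lattice_point_zero[OF gc])
      have fb: "\<bar>real_of_int (f b i)\<bar> \<le> E" if "i < k" for i
        using close[OF b f[OF b] b0 _ that] by simp
      have "inv (?h (\<lambda>i. w i + f b i)) \<otimes> x = inv (?h (f b)) \<otimes> b"
        using h Suc.prems(1) by (simp add: b_def lattice_point_add[OF gc] inv_mult m_ac)
      then have "len (inv (?h (\<lambda>i. w i + f b i)) \<otimes> x) \<le> D" using f[OF b] by simp
      moreover have "\<bar>real_of_int (w i + f b i)\<bar> \<le> E * real (Suc n)" if "i < k" for i
        using w(2)[OF that] fb[OF that] by (simp add: algebra_simps)
      ultimately show ?thesis by blast
    qed
  qed
  have f_le: "\<bar>real_of_int (f x i)\<bar> \<le> E * real (len x) + E" if x: "x \<in> carrier G" and i: "i < k" for x i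
  proof -
    obtain w where w: "len (inv (?h w) \<otimes> x) \<le> D" "\<bar>real_of_int (w i)\<bar> \<le> E * real (len x)"
      using approx[OF x order_refl] i by blast
    show ?thesis using close[OF x f[OF x] w(1) _ i] w(2) by simp
  qed
  define v where "v = (\<lambda>x i. SOME L. \<forall>n::nat. \<bar>of_int (f (x [^] n) i) - real n * L\<bar> \<le> E)"
  have v: "\<bar>of_int (f (x [^] n) i) - real n * v x i\<bar> \<le> E"
    if x: "x \<in> carrier G" and i: "i < k" for x i and n :: nat
  proof -
    have "\<exists>L. \<forall>n::nat. \<bar>of_int (f (x [^] n) i) - real n * L\<bar> \<le> E"
      using quasi[OF _ _ i] x
      by (intro quasi_additive_sequence_linear) (simp add: nat_pow_mult[symmetric])
    from someI_ex[OF this] show ?thesis by (simp add: v_def)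
  qed
  have v1: "\<bar>of_int (f x i) - v x i\<bar> \<le> E" if "x \<in> carrier G" "i < k" for x i
    using v[OF that, of 1] that by simp
  have zero: "c = 0" if "\<And>n::nat. real n * \<bar>c\<bar> \<le> b" for b c :: real
  proof (rule ccontr)
    assume "c \<noteq> 0"
    then obtain n :: nat where "b < real n * \<bar>c\<bar>" using reals_Archimedean3[of "\<bar>c\<bar>"] by auto
    then show False using that[of n] by linarith
  qed
  have v_add: "v (x \<otimes> y) i = v x i + v y i" if xy: "x \<in> carrier G" "y \<in> carrier G" and i: "i < k" for x y i
  proof -
    have "real n * \<bar>v (x \<otimes> y) i - (v x i + v y i)\<bar> \<le> 4 * E" for n
    proof -
      have "(x \<otimes> y) [^] n = x [^] n \<otimes> y [^] n" using xy by (simp add: nat_pow_distrib)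
      then have "\<bar>real n * v (x \<otimes> y) i - real n * v x i - real n * v y i\<bar> \<le> 4 * E"
        using v[OF m_closed[OF xy] i, of n] v[OF xy(1) i, of n] v[OF xy(2) i, of n]
          quasi[OF _ _ i, of "x [^] n" "y [^] n"] xy by simp
      moreover have "real n * \<bar>v (x \<otimes> y) i - (v x i + v y i)\<bar>
          = \<bar>real n * (v (x \<otimes> y) i - (v x i + v y i))\<bar>" by (simp add: abs_mult)
      ultimately show ?thesis by (simp add: algebra_simps)
    qed
    from zero[OF this] show ?thesis by simp
  qed
  have v_lattice: "v (?h z) i = of_int (z i)" if i: "i < k" for z i
  proof -
    have "real n * \<bar>v (?h z) i - of_int (z i)\<bar> \<le> 2 * E" for n
    proof -
      let ?nz = "\<lambda>i. int n * z i"
      have pow: "?h z [^] n = ?h ?nz" by (rule lattice_point_pow[OF gc])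
      have "len (inv (?h ?nz) \<otimes> ?h ?nz) \<le> 0" using h by (simp add: len_one)
      from close[OF h f[OF h] this _ i] have "\<bar>of_int (f (?h ?nz) i) - real n * of_int (z i)\<bar> \<le> E"
        by simp
      then have "\<bar>real n * v (?h z) i - real n * of_int (z i)\<bar> \<le> 2 * E"
        using v[OF h[of k z] i, of n] unfolding pow by linarith
      moreover have "real n * \<bar>v (?h z) i - of_int (z i)\<bar> = \<bar>real n * (v (?h z) i - of_int (z i))\<bar>"
        by (simp add: abs_mult)
      ultimately show ?thesis by (simp add: algebra_simps)
    qed
    from zero[OF this] show ?thesis by simp
  qed
  define L where "L = (\<Sum>i<k. real (len (g i)))"
  define A where "A = 1 + real D + real k * L * (E + 1) + 2 * real k * E"
  have L: "0 \<le> L" by (simp add: L_def sum_nonneg)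
  show thesis
  proof (rule that[of A v])
    show "1 \<le> A" using L E by (simp add: A_def)
    show "real (len x) \<le> A * L2_set (v x) {..<k} + A" if x: "x \<in> carrier G" for x
    proof -
      let ?n = "L2_set (v x) {..<k}"
      have fx: "\<bar>real_of_int (f x i)\<bar> \<le> ?n + E" if "i < k" for i
        using v1[OF x that] abs_le_L2_set[of "{..<k}" i "v x"] that by simp
      have "real (len (?h (f x))) \<le> (\<Sum>i<k. \<bar>real_of_int (f x i)\<bar> * real (len (g i)))"
        using len_lattice_point[OF gc, of k "f x"]
        by (simp add: of_nat_nat flip: of_nat_le_iff[where 'a = real])
      also have "\<dots> \<le> (\<Sum>i<k. (?n + E) * L)"
      proof (rule sum_mono)
        fix i assume "i \<in> {..<k}"
        then show "\<bar>real_of_int (f x i)\<bar> * real (len (g i)) \<le> (?n + E) * L"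
          using fx[of i] E unfolding L_def by (intro mult_mono member_le_sum) auto
      qed
      finally have "real (len (?h (f x))) \<le> real k * ((?n + E) * L)" by simp
      moreover have "len x \<le> D + len (?h (f x))"
        using len_cancel[of x "inv (?h (f x))"] f[OF x] x h by (simp add: m_comm len_inv)
      ultimately have "real (len x) \<le> real D + real k * ((?n + E) * L)" by linarith
      also have "\<dots> = real k * L * ?n + (real D + real k * L * E)" by (simp add: algebra_simps)
      also have "\<dots> \<le> A * ?n + A"
      proof (intro add_mono mult_right_mono)
        show "real k * L \<le> A" using L E by (simp add: A_def algebra_simps)
        show "real D + real k * L * E \<le> A" using L E by (simp add: A_def algebra_simps)
      qed simp
      finally show ?thesis .
    qed
    show "L2_set (v x) {..<k} \<le> A * real (len x) + A" if x: "x \<in> carrier G" for x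
    proof -
      have "\<bar>v x i\<bar> \<le> E * real (len x) + 2 * E" if "i < k" for i
        using v1[OF x that] f_le[OF x that] by linarith
      then have "L2_set (v x) {..<k} \<le> real k * (E * real (len x) + 2 * E)"
        by (rule L2_set_le_bound)
      also have "\<dots> = (real k * E) * real (len x) + 2 * real k * E" by (simp add: algebra_simps)
      also have "\<dots> \<le> A * real (len x) + A"
        using L E by (intro add_mono mult_right_mono) (simp_all add: A_def)
      finally show ?thesis .
    qed
  qed (use v_add v_lattice in auto)
qed

end

section \<open>Existence of lattices\<close>

text \<open>The coarse substitute for local compactness: every ball is covered by finitely many translates of
one fixed ball, however large its radius.\<close>

locale doubling_length_group = length_group +
  fixes m :: nat
  assumes doubling: "\<And>r. \<exists>F. finite F \<and> F \<subseteq> carrier G \<and>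
    (\<forall>x\<in>carrier G. len x \<le> r \<longrightarrow> (\<exists>f\<in>F. len (inv f \<otimes> x) \<le> m))"
begin

text \<open>Cover the ball of radius \<open>m + 1\<close> by finitely many translates of the ball of radius \<open>m\<close>. If \<open>y\<close> is
within \<open>m\<close> of a product of the centres, then a neighbour of \<open>y\<close> is within \<open>m + 1\<close> of it, and one more centre
brings the error back to \<open>m\<close>.\<close>

lemma finitely_generated_coarsely:
  obtains f p where "range f \<subseteq> carrier G"
    "\<And>x. x \<in> carrier G \<Longrightarrow> \<exists>e. len (inv (lattice_point G f p e) \<otimes> x) \<le> m"
proof -
  obtain F where F: "finite F" "F \<subseteq> carrier G"
    "\<And>x. x \<in> carrier G \<Longrightarrow> len x \<le> Suc m \<Longrightarrow> \<exists>f\<in>F. len (inv f \<otimes> x) \<le> m"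
    using doubling[of "Suc m"] by blast
  obtain p and f0 :: "nat \<Rightarrow> 'a" where p: "F = f0 ` {i. i < p}"
    using finite_imp_nat_seg_image_inj_on[OF F(1)] by blast
  define f where "f = (\<lambda>i. if i < p then f0 i else \<one>)"
  have f: "range f \<subseteq> carrier G" and Ff: "F = f ` {..<p}"
    using F(2) p by (auto simp: f_def)
  have "\<exists>e. len (inv (lattice_point G f p e) \<otimes> x) \<le> m" if "x \<in> carrier G" "len x \<le> n" for x n
    using that
  proof (induction n arbitrary: x)
    case 0
    then show ?case
      using f by (intro exI[of _ "\<lambda>_. 0"]) (simp add: lattice_point_zero)
  next
    case (Suc n)
    show ?case
    proof (cases "len x \<le> n")
      case True
      then show ?thesis using Suc by blast
    next
      case False
      then have "len x = Suc n" using Suc.prems by simp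
      then obtain s y where sy: "s \<in> carrier G" "y \<in> carrier G" "x = s \<otimes> y" "len s \<le> 1" "len y \<le> n"
        using len_split Suc.prems(1) by blast
      then obtain e where e: "len (inv (lattice_point G f p e) \<otimes> y) \<le> m" using Suc.IH by blast
      let ?h = "lattice_point G f p e"
      have h: "?h \<in> carrier G" using f by simp
      have "inv ?h \<otimes> x = s \<otimes> (inv ?h \<otimes> y)" using h sy by (simp add: m_ac)
      then have "len (inv ?h \<otimes> x) \<le> Suc m"
        using len_mult[of s "inv ?h \<otimes> y"] e sy h by simp
      then obtain j where j: "j < p" "len (inv (f j) \<otimes> (inv ?h \<otimes> x)) \<le> m"
        using F(3)[of "inv ?h \<otimes> x"] h Suc.prems Ff by auto
      have fj: "f j \<in> carrier G" using f by auto
      have "lattice_point G f p (\<lambda>i. e i + (if i = j then 1 else 0)) = ?h \<otimes> f j"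
        using lattice_point_add[OF f] lattice_point_unit[OF f j(1)] by simp
      moreover have "inv (?h \<otimes> f j) \<otimes> x = inv (f j) \<otimes> (inv ?h \<otimes> x)"
        using h fj Suc.prems(1) by (simp add: inv_mult m_ac)
      ultimately show ?thesis using j(2) by metis
    qed
  qed
  then show thesis using that f by blast
qed

text \<open>Let \<open>P r\<close> be the set of exponents of powers of \<open>x\<close> within \<open>r\<close> of the lattice points. If some \<open>P r\<close> is
infinite, then \<open>recurrent_differences\<close> applies. Otherwise each ball bounds the exponent of \<open>x\<close>, and then
also the part in the old generators.\<close>

lemma proper_extend_or_absorb:
  assumes g: "proper g k" and x: "x \<in> carrier G"
  shows "proper (g(k := x)) (Suc k) \<or> (\<exists>r. \<forall>n::int. \<exists>z. len (inv (lattice_point G g k z) \<otimes> x [^] n) \<le> r)"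
proof -
  let ?h = "lattice_point G g k"
  have gc: "range g \<subseteq> carrier G" using g by (simp add: proper_def)
  note h = lattice_point_closed[OF gc]
  define P where "P = (\<lambda>r. {n::int. \<exists>z. len (inv (?h z) \<otimes> x [^] n) \<le> r})"
  have P: "n \<in> P r \<longleftrightarrow> (\<exists>z. len (inv (?h z) \<otimes> x [^] n) \<le> r)" for n r by (simp add: P_def)
  show ?thesis
  proof (cases "\<exists>r. infinite (P r)")
    case True
    then obtain r where r: "infinite (P r)" by blast
    have "\<exists>s. P s = UNIV"
    proof (rule recurrent_differences[where P = P and c = "m + m" and r = r])
      show "a + b \<in> P (s + t)" if ab: "a \<in> P s" "b \<in> P t" for s t a b
      proof -
        obtain z w where zw: "len (inv (?h z) \<otimes> x [^] a) \<le> s" "len (inv (?h w) \<otimes> x [^] b) \<le> t"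
          using ab P by blast
        have "inv (?h (\<lambda>i. z i + w i)) \<otimes> x [^] (a + b)
            = (inv (?h z) \<otimes> x [^] a) \<otimes> (inv (?h w) \<otimes> x [^] b)"
          using x h by (simp add: lattice_point_add[OF gc] int_pow_mult inv_mult m_ac)
        then have "len (inv (?h (\<lambda>i. z i + w i)) \<otimes> x [^] (a + b)) \<le> s + t"
          using len_mult[of "inv (?h z) \<otimes> x [^] a" "inv (?h w) \<otimes> x [^] b"] zw x h by simp
        then show ?thesis unfolding P by (rule exI[of _ "\<lambda>i. z i + w i"])
      qed
      show "- n \<in> P s" if n: "n \<in> P s" for s n
      proof -
        obtain z where z: "len (inv (?h z) \<otimes> x [^] n) \<le> s" using n P by blast
        have "inv (?h (\<lambda>i. - z i)) \<otimes> x [^] (- n) = inv (inv (?h z) \<otimes> x [^] n)"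
          using x h by (simp add: lattice_point_minus[OF gc] int_pow_neg inv_mult)
        then have "len (inv (?h (\<lambda>i. - z i)) \<otimes> x [^] (- n)) \<le> s"
          using z x h len_inv[of "inv (?h z) \<otimes> x [^] n"] by simp
        then show ?thesis unfolding P by (rule exI[of _ "\<lambda>i. - z i"])
      qed
      show "P s \<subseteq> P t" if "s \<le> t" for s t using that P by (meson order_trans subsetI)
      show "\<exists>s. n \<in> P s" for n using P by blast
      show "\<exists>K. finite K \<and> (\<forall>n\<in>P s. \<exists>\<kappa>\<in>K. n - \<kappa> \<in> P (m + m))" for s
      proof -
        obtain F where F: "finite F" "F \<subseteq> carrier G"
          "\<And>y. y \<in> carrier G \<Longrightarrow> len y \<le> s \<Longrightarrow> \<exists>f\<in>F. len (inv f \<otimes> y) \<le> m"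
          using doubling[of s] by blast
        \<comment> \<open>For each centre \<open>f\<close> one exponent of a power close to \<open>f\<close> serves as \<open>\<kappa>\<close>; two powers close to the same
          centre, modulo lattice points, differ by an element of length at most \<open>2 m\<close>.\<close>
        define near where "near = (\<lambda>f (n::int). \<exists>z. len (inv f \<otimes> (inv (?h z) \<otimes> x [^] n)) \<le> m)"
        define \<kappa> where "\<kappa> = (\<lambda>f. SOME n. near f n)"
        have "\<exists>\<kappa>'\<in>\<kappa> ` F. n - \<kappa>' \<in> P (m + m)" if n: "n \<in> P s" for n
        proof -
          obtain z where z: "len (inv (?h z) \<otimes> x [^] n) \<le> s" using n P by blast
          then obtain f where f: "f \<in> F" "len (inv f \<otimes> (inv (?h z) \<otimes> x [^] n)) \<le> m"
            using F(3)[of "inv (?h z) \<otimes> x [^] n"] x h by auto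
          then have "near f n" by (auto simp: near_def)
          then have "near f (\<kappa> f)" unfolding \<kappa>_def by (rule someI)
          then obtain w where w: "len (inv f \<otimes> (inv (?h w) \<otimes> x [^] \<kappa> f)) \<le> m"
            by (auto simp: near_def)
          have fc: "f \<in> carrier G" using f F(2) by auto
          let ?a = "inv f \<otimes> (inv (?h z) \<otimes> x [^] n)" and ?b = "inv f \<otimes> (inv (?h w) \<otimes> x [^] \<kappa> f)"
          have ab: "?a \<in> carrier G" "?b \<in> carrier G" using fc x h by auto
          have "?b \<otimes> (inv (?h (\<lambda>i. z i - w i)) \<otimes> x [^] (n - \<kappa> f)) = ?a"
          proof -
            have 1: "inv (?h w) \<otimes> inv (?h (\<lambda>i. z i - w i)) = inv (?h z)"
              using lattice_point_add[OF gc, of k w "\<lambda>i. z i - w i"] h by (simp flip: inv_mult)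
            have 2: "x [^] \<kappa> f \<otimes> x [^] (n - \<kappa> f) = x [^] n"
              using x by (simp flip: int_pow_mult)
            have "?b \<otimes> (inv (?h (\<lambda>i. z i - w i)) \<otimes> x [^] (n - \<kappa> f))
              = inv f \<otimes> ((inv (?h w) \<otimes> inv (?h (\<lambda>i. z i - w i))) \<otimes> (x [^] \<kappa> f \<otimes> x [^] (n - \<kappa> f)))"
              using fc x h by (simp add: m_ac)
            then show ?thesis by (simp only: 1 2)
          qed
          then have "inv (?h (\<lambda>i. z i - w i)) \<otimes> x [^] (n - \<kappa> f) = inv ?b \<otimes> ?a"
            using ab x h by (intro inv_solve_left[THEN iffD2]) simp_all
          then have "len (inv (?h (\<lambda>i. z i - w i)) \<otimes> x [^] (n - \<kappa> f)) \<le> m + m"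
            using len_mult[of "inv ?b" ?a] len_inv[of ?b] ab w f(2) by simp
          then show ?thesis using P f(1) by blast
        qed
        then show ?thesis using F(1) by blast
      qed
      show "infinite (P r)" by (rule r)
    qed
    then show ?thesis using P by blast
  next
    case False
    have "proper (g(k := x)) (Suc k)"
      unfolding proper_def
    proof (intro conjI allI)
      show "range (g(k := x)) \<subseteq> carrier G" using gc x by auto
      fix r
      define N where "N = Max (insert 0 (abs ` P r))"
      have N: "\<bar>n\<bar> \<le> N" if "n \<in> P r" for n using that False by (auto simp: N_def)
      obtain C where C: "\<And>z. len (?h z) \<le> r + nat N * len x \<Longrightarrow> \<forall>i<k. \<bar>z i\<bar> \<le> C"
        using g unfolding proper_def by metis
      have "\<forall>i<Suc k. \<bar>z i\<bar> \<le> max C N" if z: "len (lattice_point G (g(k := x)) (Suc k) z) \<le> r" for z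
      proof -
        have eq: "lattice_point G (g(k := x)) (Suc k) z = ?h z \<otimes> x [^] z k"
          using lattice_point_cong[of k "g(k := x)" g z z G] by simp
        have "inv (?h (\<lambda>i. - z i)) = ?h z" using h by (simp add: lattice_point_minus[OF gc])
        then have "z k \<in> P r" using z eq P by metis
        then have k: "\<bar>z k\<bar> \<le> N" by (rule N)
        have "len (?h z) \<le> r + len (x [^] z k)"
          using len_cancel[of "?h z" "x [^] z k"] z eq h x by simp
        also have "len (x [^] z k) \<le> nat N * len x"
          using len_int_pow[OF x, of "z k"] k mult_le_mono1[of "nat \<bar>z k\<bar>" "nat N" "len x"] by linarith
        finally have "\<forall>i<k. \<bar>z i\<bar> \<le> C" using C by simp
        then show ?thesis using k by (auto simp: less_Suc_eq le_max_iff_disj)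
      qed
      then show "\<exists>C. \<forall>z. len (lattice_point G (g(k := x)) (Suc k) z) \<le> r \<longrightarrow> (\<forall>i<Suc k. \<bar>z i\<bar> \<le> C)"
        by blast
    qed
    then show ?thesis ..
  qed
qed

text \<open>Run through the finitely many elements \<open>f 0, f 1, \<dots>\<close> that generate the group up to bounded error, and
keep those that extend the lattice; the other ones stay within bounded distance of it.\<close>

theorem lattice_exists: "\<exists>g k. lattice g k"
proof -
  obtain f p where f: "range f \<subseteq> carrier G"
    and fp: "\<And>x. x \<in> carrier G \<Longrightarrow> \<exists>e. len (inv (lattice_point G f p e) \<otimes> x) \<le> m"
    using finitely_generated_coarsely by blast
  have "\<exists>g k r. proper g k \<and>
    (\<forall>e. \<exists>z. len (inv (lattice_point G g k z) \<otimes> lattice_point G f q e) \<le> r)" for q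
  proof (induction q)
    case 0
    have "proper (\<lambda>_. \<one>) 0" by (auto simp: proper_def)
    then show ?case by (intro exI[of _ "\<lambda>_. \<one>"] exI[of _ 0]) (simp add: len_one)
  next
    case (Suc q)
    then obtain g k r where g: "proper g k"
      and r: "\<And>e. \<exists>z. len (inv (lattice_point G g k z) \<otimes> lattice_point G f q e) \<le> r"
      by blast
    have gc: "range g \<subseteq> carrier G" using g by (simp add: proper_def)
    let ?h = "lattice_point G g k" and ?f = "lattice_point G f q"
    note h = lattice_point_closed[OF gc] and fc = lattice_point_closed[OF f]
    have x: "f q \<in> carrier G" using f by auto
    from proper_extend_or_absorb[OF g x] show ?case
    proof
      assume ext: "proper (g(k := f q)) (Suc k)"
      have "\<exists>z. len (inv (lattice_point G (g(k := f q)) (Suc k) z) \<otimes> lattice_point G f (Suc q) e) \<le> r" for e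
      proof -
        obtain z where z: "len (inv (?h z) \<otimes> ?f e) \<le> r" using r by blast
        let ?z = "z(k := e q)"
        have "lattice_point G (g(k := f q)) (Suc k) ?z = ?h z \<otimes> f q [^] e q"
          using lattice_point_cong[of k "g(k := f q)" g ?z z G] by simp
        moreover have "inv (?h z \<otimes> f q [^] e q) \<otimes> (?f e \<otimes> f q [^] e q) = inv (?h z) \<otimes> ?f e"
        proof -
          have "inv (?h z \<otimes> f q [^] e q) \<otimes> (?f e \<otimes> f q [^] e q)
            = inv (?h z) \<otimes> ?f e \<otimes> (inv (f q [^] e q) \<otimes> f q [^] e q)"
            using h fc x by (simp add: inv_mult m_ac)
          then show ?thesis using h fc x by simp
        qed
        ultimately show ?thesis using z by (intro exI[of _ ?z]) simp
      qed
      then show ?thesis using ext by blast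
    next
      assume "\<exists>r. \<forall>n::int. \<exists>z. len (inv (?h z) \<otimes> f q [^] n) \<le> r"
      then obtain s where s: "\<And>n::int. \<exists>z. len (inv (?h z) \<otimes> f q [^] n) \<le> s" by blast
      have "\<exists>z. len (inv (?h z) \<otimes> lattice_point G f (Suc q) e) \<le> r + s" for e
      proof -
        obtain z w where z: "len (inv (?h z) \<otimes> ?f e) \<le> r" and w: "len (inv (?h w) \<otimes> f q [^] e q) \<le> s"
          using r s by meson
        have "inv (?h (\<lambda>i. z i + w i)) \<otimes> lattice_point G f (Suc q) e
          = (inv (?h z) \<otimes> ?f e) \<otimes> (inv (?h w) \<otimes> f q [^] e q)"
          using h fc x by (simp add: lattice_point_add[OF gc] inv_mult m_ac)
        then have "len (inv (?h (\<lambda>i. z i + w i)) \<otimes> lattice_point G f (Suc q) e) \<le> r + s"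
          using len_mult[of "inv (?h z) \<otimes> ?f e" "inv (?h w) \<otimes> f q [^] e q"] z w h fc x by simp
        then show ?thesis by (rule exI[of _ "\<lambda>i. z i + w i"])
      qed
      then show ?thesis using g by blast
    qed
  qed
  then obtain g k r where g: "proper g k"
    and r: "\<And>e. \<exists>z. len (inv (lattice_point G g k z) \<otimes> lattice_point G f p e) \<le> r"
    by blast
  have gc: "range g \<subseteq> carrier G" using g by (simp add: proper_def)
  note h = lattice_point_closed[OF gc] and fc = lattice_point_closed[OF f]
  have "\<exists>z. len (inv (lattice_point G g k z) \<otimes> x) \<le> r + m" if x: "x \<in> carrier G" for x
  proof -
    obtain e where e: "len (inv (lattice_point G f p e) \<otimes> x) \<le> m" using fp[OF x] by blast
    obtain z where z: "len (inv (lattice_point G g k z) \<otimes> lattice_point G f p e) \<le> r" using r by blast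
    have "inv (lattice_point G g k z) \<otimes> x
      = (inv (lattice_point G g k z) \<otimes> lattice_point G f p e) \<otimes> (inv (lattice_point G f p e) \<otimes> x)"
      using h fc x by (simp add: m_assoc) (simp flip: m_assoc)
    then show ?thesis
      using len_mult[of "inv (lattice_point G g k z) \<otimes> lattice_point G f p e"
          "inv (lattice_point G f p e) \<otimes> x"] e z h fc x by (intro exI[of _ z]) auto
  qed
  then show ?thesis using g unfolding lattice_def by blast
qed

end

section \<open>Word lengths in compactly generated abelian groups\<close>

definition word_length :: "('a, 'm) monoid_scheme \<Rightarrow> 'a set \<Rightarrow> 'a \<Rightarrow> nat" where
  "word_length G S x = Inf {n. x \<in> set_pow G S n}"

lemma word_length_le: "x \<in> set_pow G S n \<Longrightarrow> word_length G S x \<le> n"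
  unfolding word_length_def by (rule cInf_lower) auto

lemma word_metric_eq:
  "g \<in> carrier G \<Longrightarrow> h \<in> carrier G \<Longrightarrow>
    word_metric G S g h = real (word_length G S (inv\<^bsub>G\<^esub> g \<otimes>\<^bsub>G\<^esub> h))"
  by (simp add: word_metric_def word_length_def)

lemma (in group) set_pow_word_length:
  assumes "S \<subseteq> carrier G" "set_inv S = S" "generate G S = carrier G" "x \<in> carrier G"
  shows "x \<in> set_pow G S (word_length G S x)"
proof -
  have "{n. x \<in> set_pow G S n} \<noteq> {}" using generate_set_pow[of S x] assms by auto
  from Inf_nat_def1[OF this] show ?thesis by (simp add: word_length_def)
qed

lemma (in comm_group) length_group_word_length:
  assumes S: "S \<subseteq> carrier G" "set_inv S = S" "generate G S = carrier G"
  shows "length_group G (word_length G S)"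
proof
  note mem = set_pow_word_length[OF S]
  have one: "\<one> \<in> set_pow G S 0" by simp
  show "word_length G S \<one> = 0" using word_length_le[OF one] by simp
  show "word_length G S (x \<otimes> y) \<le> word_length G S x + word_length G S y"
    if "x \<in> carrier G" "y \<in> carrier G" for x y
    using that by (intro word_length_le set_pow_add S mem)
  have le: "word_length G S (inv x) \<le> word_length G S x" if "x \<in> carrier G" for x
    using that by (intro word_length_le set_pow_inv S mem)
  show "word_length G S (inv x) = word_length G S x" if "x \<in> carrier G" for x
    using le[of x] le[of "inv x"] that by simp
  show "\<exists>s\<in>carrier G. \<exists>y\<in>carrier G. x = s \<otimes> y \<and> word_length G S s \<le> 1 \<and> word_length G S y \<le> n"
    if x: "x \<in> carrier G" "word_length G S x = Suc n" for x n
  proof -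
    obtain s y where sy: "s \<in> S" "y \<in> set_pow G S n" "x = s \<otimes> y"
      using mem[OF x(1)] x(2) by (auto simp: set_mult_def)
    then have "s \<in> set_pow G S 1" by (intro set_pow_1 S)
    then show ?thesis
      using sy S(1) set_pow_subset[OF S(1), of n] word_length_le[of s G S 1] word_length_le[of y G S n] by blast
  qed
qed

locale compactly_generated_abelian_group =
  comm_group G + topological_group G T for G (structure) and T +
  fixes S :: "'a set"
  assumes Hausdorff: "Hausdorff_space T"
    and loc_compact: "locally_compact_space T"
    and generating: "compact_generating_set G T S"
begin

abbreviation len :: "'a \<Rightarrow> nat" where
  "len \<equiv> word_length G S"

lemma generating_set: "S \<subseteq> carrier G" "set_inv S = S" "generate G S = carrier G"
  using generating compactin_subset_topspace topspace_eq by (auto simp: compact_generating_set_def)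

sublocale length_group G len
  by (rule length_group_word_length[OF generating_set])

lemma compactin_set_pow: "compactin T (set_pow G S n)"
proof (induction n)
  case 0
  then show ?case by (simp add: topspace_eq)
next
  case (Suc n)
  have "S <#> set_pow G S n = (\<lambda>(x, y). x \<otimes> y) ` (S \<times> set_pow G S n)"
    by (auto simp: set_mult_def)
  moreover have "compactin (prod_topology T T) (S \<times> set_pow G S n)"
    using Suc generating by (auto simp: compactin_Times compact_generating_set_def)
  ultimately show ?case using image_compactin[OF _ continuous_mult] by simp
qed

lemma compactin_ball: "compactin T {x \<in> carrier G. len x \<le> r}"
proof -
  have "{x \<in> carrier G. len x \<le> r} = \<Union> (set_pow G S ` {..r})"
    using set_pow_word_length[OF generating_set] set_pow_subset[OF generating_set(1)] by (auto dest: word_length_le)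
  moreover have "compactin T (\<Union> (set_pow G S ` {..r}))"
    by (rule compactin_Union) (auto simp: compactin_set_pow)
  ultimately show ?thesis by simp
qed

lemma continuous_translation:
  assumes "a \<in> carrier G"
  shows "continuous_map T T (\<lambda>x. a \<otimes> x)"
proof -
  have "continuous_map T (prod_topology T T) (\<lambda>x. (a, x))"
    using assms by (simp add: continuous_map_pairedI topspace_eq)
  from continuous_map_compose[OF this continuous_mult] show ?thesis by (simp add: o_def)
qed

lemma openin_translate:
  assumes "openin T U" "a \<in> carrier G"
  shows "openin T {x \<in> carrier G. a \<otimes> x \<in> U}"
  using openin_continuous_map_preimage[OF continuous_translation[OF assms(2)] assms(1)]
  by (simp add: topspace_eq)

text \<open>The group is the union of the countably many compact sets \<open>S\<^sup>n\<close>, so by Baire's theorem one of them has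
interior points. This is what links the topology with the word length.\<close>

lemma open_bounded_set:
  obtains U m where "openin T U" "U \<noteq> {}" "\<And>u. u \<in> U \<Longrightarrow> len u \<le> m"
proof -
  have "\<exists>m. T interior_of set_pow G S m \<noteq> {}"
  proof (rule ccontr)
    assume "\<not> ?thesis"
    then have "T interior_of \<Union> (range (set_pow G S)) = {}"
      using loc_compact Hausdorff compactin_set_pow locally_compact_Hausdorff_imp_regular_space
      by (intro Baire_category_alt) (auto intro: compactin_imp_closedin)
    moreover have "\<Union> (range (set_pow G S)) = topspace T"
      using set_pow_word_length[OF generating_set] set_pow_subset[OF generating_set(1)] topspace_eq by blast
    ultimately have "topspace T = {}" by simp
    then show False using topspace_eq one_closed by blast
  qed
  then obtain m where "T interior_of set_pow G S m \<noteq> {}" by blast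
  then show thesis
    using that[of "T interior_of set_pow G S m" m] interior_of_subset word_length_le
    by (metis openin_interior_of subsetD)
qed

text \<open>A fixed nonempty open set of bounded length. Its translates form an open cover by sets of uniformly
bounded size, to which compactness is applied.\<close>

definition cell :: "'a set" where
  "cell = (SOME U. openin T U \<and> U \<noteq> {} \<and> (\<exists>m. \<forall>u\<in>U. len u \<le> m))"

definition width :: nat where
  "width = (SOME m. \<forall>u\<in>cell. len u \<le> m)"

lemma cell: "openin T cell" "cell \<noteq> {}" "\<And>u. u \<in> cell \<Longrightarrow> len u \<le> width"
proof -
  have "\<exists>U. openin T U \<and> U \<noteq> {} \<and> (\<exists>m. \<forall>u\<in>U. len u \<le> m)"
    using open_bounded_set by metis
  from someI_ex[OF this] have *: "openin T cell" "cell \<noteq> {}" "\<exists>m. \<forall>u\<in>cell. len u \<le> m"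
    unfolding cell_def by blast+
  show "openin T cell" "cell \<noteq> {}" by (fact *)+
  show "len u \<le> width" if "u \<in> cell" for u
    using someI_ex[OF *(3)] that by (simp add: width_def)
qed

definition tile :: "'a \<Rightarrow> 'a set" where
  "tile a = {x \<in> carrier G. inv a \<otimes> x \<in> cell}"

lemma openin_tile: "a \<in> carrier G \<Longrightarrow> openin T (tile a)"
  unfolding tile_def by (intro openin_translate cell) auto

lemma tile_len: "x \<in> tile a \<Longrightarrow> len (inv a \<otimes> x) \<le> width"
  using cell(3) by (auto simp: tile_def)

lemma in_some_tile:
  assumes "x \<in> carrier G"
  shows "\<exists>a\<in>carrier G. x \<in> tile a"
proof -
  obtain u where u: "u \<in> cell" "u \<in> carrier G"
    using cell(1,2) openin_subset topspace_eq by blast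
  have "inv (x \<otimes> inv u) \<otimes> x = u" using assms u by (simp add: inv_mult m_ac)
  then show ?thesis using u assms by (intro bexI[of _ "x \<otimes> inv u"]) (auto simp: tile_def)
qed

lemma compactin_finite_cover:
  assumes "compactin T K"
  shows "\<exists>F. finite F \<and> F \<subseteq> carrier G \<and> (\<forall>x\<in>K. \<exists>f\<in>F. len (inv f \<otimes> x) \<le> width)"
proof -
  have "K \<subseteq> \<Union> (tile ` carrier G)"
    using in_some_tile compactin_subset_topspace[OF assms] topspace_eq by blast
  then obtain \<F> where \<F>: "finite \<F>" "\<F> \<subseteq> tile ` carrier G" "K \<subseteq> \<Union> \<F>"
    using compactinD[OF assms, of "tile ` carrier G"] openin_tile by auto
  obtain F where "F \<subseteq> carrier G" "finite F" "\<F> = tile ` F"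
    using finite_subset_image[OF \<F>(1,2)] by blast
  then show ?thesis using \<F>(3) tile_len by (intro exI[of _ F]) blast
qed

lemma len_le_if_near_finite:
  assumes "finite F" "F \<subseteq> carrier G"
  shows "\<exists>r. \<forall>f\<in>F. \<forall>x\<in>carrier G. len (inv f \<otimes> x) \<le> w \<longrightarrow> len x \<le> r"
proof -
  have "len x \<le> Max (insert 0 (len ` F)) + w"
    if "f \<in> F" "x \<in> carrier G" "len (inv f \<otimes> x) \<le> w" for f x
  proof -
    have f: "f \<in> carrier G" using that assms by auto
    have "len f \<le> Max (insert 0 (len ` F))" using that assms(1) by auto
    moreover have "f \<otimes> (inv f \<otimes> x) = x" using f that by (simp flip: m_assoc)
    ultimately show ?thesis using len_mult[of f "inv f \<otimes> x"] f that by simp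
  qed
  then show ?thesis by blast
qed

lemma compactin_bounded:
  assumes "compactin T K"
  shows "\<exists>r. \<forall>x\<in>K. len x \<le> r"
proof -
  obtain F where F: "finite F" "F \<subseteq> carrier G" "\<forall>x\<in>K. \<exists>f\<in>F. len (inv f \<otimes> x) \<le> width"
    using compactin_finite_cover[OF assms] by blast
  have "K \<subseteq> carrier G" using compactin_subset_topspace[OF assms] topspace_eq by simp
  then show ?thesis using len_le_if_near_finite[OF F(1,2), of width] F(3) by blast
qed

sublocale doubling_length_group G len width
proof
  fix r
  show "\<exists>F. finite F \<and> F \<subseteq> carrier G \<and>
      (\<forall>x\<in>carrier G. len x \<le> r \<longrightarrow> (\<exists>f\<in>F. len (inv f \<otimes> x) \<le> width))"
    using compactin_finite_cover[OF compactin_ball[of r]] by (simp add: Ball_def imp_conjL)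
qed

text \<open>In the chart of the lattice the orbit of \<open>x\<close> consists of the multiples of \<open>v x\<close>, and the orbits of the
lattice points themselves provide all integer vectors.\<close>

theorem boundaries_if_lattice:
  assumes lat: "lattice g k" and p: "p \<in> carrier G"
  shows "linear_boundary G S p homeomorphic_space sphere_in k"
    and "projective_boundary G S p homeomorphic_space projective_in k"
proof -
  obtain v A where A: "1 \<le> A"
    and add: "\<And>x y i. x \<in> carrier G \<Longrightarrow> y \<in> carrier G \<Longrightarrow> i < k \<Longrightarrow> v (x \<otimes> y) i = v x i + v y i"
    and up: "\<And>x. x \<in> carrier G \<Longrightarrow> real (len x) \<le> A * L2_set (v x) {..<k} + A"
    and low: "\<And>x. x \<in> carrier G \<Longrightarrow> L2_set (v x) {..<k} \<le> A * real (len x) + A"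
    and lattice: "\<And>z i. i < k \<Longrightarrow> v (lattice_point G g k z) i = real_of_int (z i)"
    by (rule lattice_chart[OF lat]) blast
  have g: "range g \<subseteq> carrier G" using lat by (simp add: lattice_def proper_def)
  have v_int_pow: "v (x [^] (n::int)) i = of_int n * v x i" if "x \<in> carrier G" "i < k" for x i n
    by (rule additive_int_pow) (use add that in auto)
  have v_pow: "v (x [^] (n::nat)) i = real n * v x i" if "x \<in> carrier G" "i < k" for x i n
    using v_int_pow[OF that, of "int n"] by (simp add: int_pow_int)
  have v_diff: "L2_set (v (inv x \<otimes> y)) {..<k} = L2_set (\<lambda>i. v x i - v y i) {..<k}"
    if "x \<in> carrier G" "y \<in> carrier G" for x y
  proof -
    have "v (inv x \<otimes> y) i = v y i - v x i" if "i < k" for i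
      using add[of "inv x" y i] additive_inv[of "\<lambda>x. v x i" x] add that \<open>x \<in> carrier G\<close> \<open>y \<in> carrier G\<close>
      by simp
    then have "L2_set (v (inv x \<otimes> y)) {..<k} = L2_set (\<lambda>i. v y i - v x i) {..<k}"
      by (intro L2_set_cong) auto
    then show ?thesis by (simp add: L2_set_diff_commute[of "v x"])
  qed
  interpret pointed_metric_space "carrier G" "word_metric G S" p
    by (rule pointed_metric_space_word_metric[OF generating_set p])
  interpret euclidean_chart "carrier G" "word_metric G S" p k v A
  proof
    fix x y assume xy: "x \<in> carrier G" "y \<in> carrier G"
    show "word_metric G S x y \<le> A * L2_set (\<lambda>i. v x i - v y i) {..<k} + A"
      using up[of "inv x \<otimes> y"] xy by (simp add: word_metric_eq v_diff)
    show "L2_set (\<lambda>i. v x i - v y i) {..<k} \<le> A * word_metric G S x y + A"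
      using low[of "inv x \<otimes> y"] xy by (simp add: word_metric_eq v_diff)
  next
    fix z :: "nat \<Rightarrow> int"
    show "\<exists>x\<in>carrier G. \<forall>i<k. v x i = of_int (z i)"
      using lattice lattice_point_closed[OF g] by blast
  qed (rule A)
  have fwd: "progression {0..} w (range (\<lambda>n::nat. x [^] n))"
    if x: "x \<in> carrier G" "\<And>i. i < k \<Longrightarrow> v x i = w i" for x w
    unfolding progression_def
  proof (intro conjI ballI allI impI)
    fix y assume "y \<in> range (\<lambda>n::nat. x [^] n)"
    then obtain n :: nat where "y = x [^] n" by blast
    then show "\<exists>n::int. real_of_int n \<in> {0..} \<and> (\<forall>i<k. v y i = real_of_int n * w i)"
      using x v_pow by (intro exI[of _ "int n"]) auto
  next
    fix n :: int assume "real_of_int n \<in> {0..}"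
    then obtain m where "n = int m" using nonneg_int_cases by auto
    then show "\<exists>y\<in>range (\<lambda>n::nat. x [^] n). \<forall>i<k. v y i = real_of_int n * w i"
      using x v_pow by (intro bexI[of _ "x [^] m"]) auto
  qed (use x in auto)
  have full: "progression UNIV w (range (\<lambda>n::int. x [^] n))"
    if x: "x \<in> carrier G" "\<And>i. i < k \<Longrightarrow> v x i = w i" for x w
    using x v_int_pow by (auto simp: progression_def)
  have J: "{0..} \<subseteq> {0::real..}" "{0::real..} \<subseteq> UNIV" by auto
  have unb: "0 < nrm w \<Longrightarrow> progression J w R \<Longrightarrow> {0..} \<subseteq> J \<Longrightarrow> R \<in> unbounded_sets" for w J R
    using progression_unbounded_iff by blast
  note point = lattice_point_closed[OF g, of k] lattice
  show "linear_boundary G S p homeomorphic_space sphere_in k"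
    unfolding linear_boundary_def
  proof (rule boundary_homeomorphic_sphere)
    show "\<exists>w. progression {0..} w R" if "R \<in> forward_orbits G \<inter> unbounded_sets" for R
      using that fwd by (fastforce simp: forward_orbits_def)
    show "\<exists>R\<in>forward_orbits G \<inter> unbounded_sets. progression {0..} (\<lambda>i. real_of_int (z i)) R"
      if z: "0 < nrm (\<lambda>i. real_of_int (z i))" for z
      using unb[OF z _ J(1)] fwd[of "lattice_point G g k z" "\<lambda>i. real_of_int (z i)"] point
      unfolding forward_orbits_def by blast
  qed simp
  show "projective_boundary G S p homeomorphic_space projective_in k"
    unfolding projective_boundary_def
  proof (rule boundary_homeomorphic_projective)
    show "\<exists>w. progression UNIV w R" if "R \<in> full_orbits G \<inter> unbounded_sets" for R
      using that full by (fastforce simp: full_orbits_def)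
    show "\<exists>R\<in>full_orbits G \<inter> unbounded_sets. progression UNIV (\<lambda>i. real_of_int (z i)) R"
      if z: "0 < nrm (\<lambda>i. real_of_int (z i))" for z
      using unb[OF z _ J(2)] full[of "lattice_point G g k z" "\<lambda>i. real_of_int (z i)"] point
      unfolding full_orbits_def by blast
  qed simp
qed

end

section \<open>Products of lines, integers and compact groups\<close>

text \<open>Continuous homomorphisms to the reals are bounded on balls, which are compact; so the coordinates of a
lattice point are bounded in terms of its length. Removing the integer parts of the coordinates of an
element by a lattice point leads into \<open>K\<close>, which has bounded length.\<close>

lemma (in compactly_generated_abelian_group) lattice_from_coordinates:
  fixes c :: "nat \<Rightarrow> 'a \<Rightarrow> real"
  assumes add: "\<And>i x y. i < k \<Longrightarrow> x \<in> carrier G \<Longrightarrow> y \<in> carrier G \<Longrightarrow> c i (x \<otimes> y) = c i x + c i y"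
    and cont: "\<And>i. i < k \<Longrightarrow> continuous_map T euclideanreal (c i)"
    and g: "range g \<subseteq> carrier G"
    and dual: "\<And>i j. i < k \<Longrightarrow> j < k \<Longrightarrow> c i (g j) = (if i = j then 1 else 0)"
    and K: "compactin T K" "\<And>x. x \<in> carrier G \<Longrightarrow> (\<And>i. i < k \<Longrightarrow> c i x \<in> {0..1}) \<Longrightarrow> x \<in> K"
  shows "lattice g k"
proof -
  note h = lattice_point_closed[OF g]
  have c: "c i (lattice_point G g k z) = of_int (z i)" if i: "i < k" for i z
  proof -
    have "c i (lattice_point G g k z) = (\<Sum>j<k. of_int (z j) * c i (g j))"
      by (rule additive_lattice_point) (use add i g in auto)
    also have "\<dots> = (\<Sum>j<k. if j = i then of_int (z i) else 0)"
      using dual[OF i] by (intro sum.cong) auto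
    also have "\<dots> = of_int (z i)" using i by simp
    finally show ?thesis .
  qed
  show ?thesis
    unfolding lattice_def proper_def
  proof (intro conjI allI g)
    fix r
    have "\<exists>C. \<forall>x\<in>carrier G. len x \<le> r \<longrightarrow> \<bar>c i x\<bar> \<le> C" if "i < k" for i
    proof -
      have "compact (c i ` {x \<in> carrier G. len x \<le> r})"
        using image_compactin[OF compactin_ball cont[OF that]] by simp
      then obtain C where "\<forall>y\<in>c i ` {x \<in> carrier G. len x \<le> r}. norm y \<le> C"
        using compact_imp_bounded bounded_iff by blast
      then show ?thesis by auto
    qed
    then obtain C where C: "\<And>i x. i < k \<Longrightarrow> x \<in> carrier G \<Longrightarrow> len x \<le> r \<Longrightarrow> \<bar>c i x\<bar> \<le> C i"
      by metis
    have "\<bar>z i\<bar> \<le> \<lceil>\<Sum>i<k. \<bar>C i\<bar>\<rceil>" if "len (lattice_point G g k z) \<le> r" "i < k" for z i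
    proof -
      have "\<bar>real_of_int (z i)\<bar> \<le> C i" using C[OF that(2) h that(1)] c[OF that(2)] by simp
      moreover have "\<bar>C i\<bar> \<le> (\<Sum>i<k. \<bar>C i\<bar>)" using that(2) by (intro member_le_sum) auto
      ultimately have "real_of_int \<bar>z i\<bar> \<le> (\<Sum>i<k. \<bar>C i\<bar>)" by simp
      then show ?thesis by linarith
    qed
    then show "\<exists>C. \<forall>z. len (lattice_point G g k z) \<le> r \<longrightarrow> (\<forall>i<k. \<bar>z i\<bar> \<le> C)" by blast
  next
    obtain D where D: "\<forall>x\<in>K. len x \<le> D" using compactin_bounded[OF K(1)] by blast
    have "\<exists>z. len (inv (lattice_point G g k z) \<otimes> x) \<le> D" if x: "x \<in> carrier G" for x
    proof -
      let ?z = "\<lambda>i. \<lfloor>c i x\<rfloor>"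
      have "c i (inv (lattice_point G g k ?z) \<otimes> x) \<in> {0..1}" if i: "i < k" for i
      proof -
        have "c i (inv (lattice_point G g k ?z) \<otimes> x) = c i x - of_int \<lfloor>c i x\<rfloor>"
          using add[OF i] additive_inv[of "c i" "lattice_point G g k ?z"] c[OF i] h x by simp
        then show ?thesis by (simp add: floor_le_iff) linarith
      qed
      then have "inv (lattice_point G g k ?z) \<otimes> x \<in> K" using K(2) h x by simp
      then show ?thesis using D by blast
    qed
    then show "\<exists>D. \<forall>x\<in>carrier G. \<exists>z. len (inv (lattice_point G g k z) \<otimes> x) \<le> D" by blast
  qed
qed

lemma (in compactly_generated_abelian_group) lattice_of_model:
  fixes C :: "'c monoid"
  assumes C: "comm_group C" "topological_group C TC" "compact_space TC"
    and iso: "topologically_isomorphic G T (model_group a b C) (model_topology a b TC)"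
  shows "\<exists>g. lattice g (a + b)"
proof -
  interpret C: comm_group C by (rule C)
  obtain f where f: "f \<in> iso G (model_group a b C)"
    and homeo: "homeomorphic_map T (model_topology a b TC) f"
    using iso by (auto simp: topologically_isomorphic_def)
  have TC: "topspace TC = carrier C" using C(2) by (rule topological_group.topspace_eq)
  have cont: "continuous_map T (model_topology a b TC) f"
    using homeo by (rule homeomorphic_imp_continuous_map)
  have hom: "f (x \<otimes> y) = f x \<otimes>\<^bsub>model_group a b C\<^esub> f y" if "x \<in> carrier G" "y \<in> carrier G" for x y
    using f that by (simp add: iso_def hom_def)
  have bij: "bij_betw f (carrier G) (carrier (model_group a b C))"
    using f by (simp add: iso_def)
  have carrier_model: "carrier (model_group a b C)
      = PiE {..<a} (\<lambda>_. UNIV) \<times> PiE {..<b} (\<lambda>_. UNIV) \<times> carrier C"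
    by (simp add: model_group_def DirProd_def real_group_def integer_group_def)
  \<comment> \<open>The coordinates of \<open>\<real>\<^sup>a\<close> come first, those of \<open>\<int>\<^sup>b\<close> are shifted by \<open>a\<close>; \<open>e i\<close> is the \<open>i\<close>-th unit
    vector.\<close>
  define c where "c = (\<lambda>i x. if i < a then fst (f x) i else real_of_int (fst (snd (f x)) (i - a)))"
  define e :: "nat \<Rightarrow> (nat \<Rightarrow> real) \<times> (nat \<Rightarrow> int) \<times> 'c" where
    "e = (\<lambda>i. (\<lambda>j\<in>{..<a}. if i = j then 1 else 0, \<lambda>j\<in>{..<b}. if i = a + j then 1 else 0, \<one>\<^bsub>C\<^esub>))"
  define g where "g = (\<lambda>i. inv_into (carrier G) f (e i))"
  have e: "e i \<in> carrier (model_group a b C)" for i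
    by (auto simp: e_def carrier_model)
  have fg: "f (g i) = e i" and g: "g i \<in> carrier G" for i
    using bij e[of i] by (auto simp: g_def bij_betw_def f_inv_into_f inv_into_into)
  \<comment> \<open>A compact box that contains all points with coordinates in \<open>{0..1}\<close>.\<close>
  let ?P = "PiE {..<a} (\<lambda>_. {0..1::real}) \<times> PiE {..<b} (\<lambda>_. {0,1::int}) \<times> topspace TC"
  have P: "compactin (model_topology a b TC) ?P"
    using C(3) by (auto simp: model_topology_def compactin_Times compactin_PiE compact_space_def
        intro!: finite_imp_compactin)
  let ?K = "{x \<in> carrier G. f x \<in> ?P}"
  have "?P \<subseteq> f ` carrier G"
    using bij TC carrier_model by (auto simp: bij_betw_def PiE_iff)
  moreover have "f ` {x \<in> carrier G. f x \<in> Q} = Q" if "Q \<subseteq> f ` carrier G" for Q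
    using that by blast
  ultimately have image: "f ` ?K = ?P" by blast
  have "?K \<subseteq> topspace T" unfolding topspace_eq by (rule Collect_restrict)
  from homeomorphic_map_compactness[OF homeo this] have K: "compactin T ?K"
    unfolding image using P by (rule iffD1)
  have "lattice g (a + b)"
  proof (rule lattice_from_coordinates[where c = c and K = ?K])
    fix i x y assume i: "i < a + b" and xy: "x \<in> carrier G" "y \<in> carrier G"
    show "c i (x \<otimes> y) = c i x + c i y"
      using i hom[OF xy]
      by (auto simp: c_def model_group_def DirProd_def real_group_def integer_group_def case_prod_beta)
  next
    fix i assume i: "i < a + b"
    have 1: "continuous_map T (product_topology (\<lambda>_. euclideanreal) {..<a}) (\<lambda>x. fst (f x))"
      and 2: "continuous_map T (product_topology (\<lambda>_. discrete_topology (UNIV :: int set)) {..<b}) (\<lambda>x. fst (snd (f x)))"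
      using cont unfolding model_topology_def
      by (simp_all add: continuous_map_prod_top continuous_map_componentwise o_def continuous_map_pairwise)
    show "continuous_map T euclideanreal (c i)"
    proof (cases "i < a")
      case True
      then show ?thesis
        using continuous_map_compose[OF 1 continuous_map_product_projection[of i "{..<a}"]]
        by (simp add: c_def o_def)
    next
      case False
      then have "continuous_map T (discrete_topology UNIV) (\<lambda>x. fst (snd (f x)) (i - a))"
        using continuous_map_compose[OF 2 continuous_map_product_projection[of "i - a" "{..<b}"]] i
        by (simp add: o_def)
      moreover have "continuous_map (discrete_topology UNIV) euclideanreal real_of_int" by simp
      ultimately show ?thesis
        using False continuous_map_compose[of T "discrete_topology UNIV" "\<lambda>x. fst (snd (f x)) (i - a)" euclideanreal real_of_int]
        by (simp add: c_def o_def)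
    qed
  next
    show "range g \<subseteq> carrier G" using g by auto
    show "c i (g j) = (if i = j then 1 else 0)" if "i < a + b" "j < a + b" for i j
      using that by (auto simp: c_def fg e_def)
  next
    fix x assume x: "x \<in> carrier G" "\<And>i. i < a + b \<Longrightarrow> c i x \<in> {0..1}"
    obtain u w y where fx: "f x = (u, w, y)" by (metis prod.exhaust)
    have "(u, w, y) \<in> carrier (model_group a b C)" using bij x(1) fx by (metis bij_betwE)
    moreover have "u i \<in> {0..1}" if "i < a" for i using x(2)[of i] that by (simp add: c_def fx)
    moreover have "w i \<in> {0,1}" if "i < b" for i using x(2)[of "a + i"] that by (simp add: c_def fx) linarith
    ultimately show "x \<in> ?K" using x(1) TC fx by (auto simp: carrier_model PiE_iff)
  qed (rule K)
  then show ?thesis by blast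
qed

section \<open>Cocompact closed subgroups\<close>

lemma (in group) lattice_point_consistent:
  assumes "subgroup H G" "range g \<subseteq> H"
  shows "lattice_point (G\<lparr>carrier := H\<rparr>) g k z = lattice_point G g k z"
proof (induction k)
  case (Suc k)
  have "g k \<in> H" using assms(2) by auto
  then show ?case using Suc int_pow_consistent[OF assms(1)] by simp
qed simp

text \<open>The images of the open tiles under the quotient map are open, because the preimage of such an image is
the union of all \<open>H\<close>-translates of the tile. Finitely many of them cover the compact quotient.\<close>

lemma (in compactly_generated_abelian_group) cocompact_finite_cover:
  assumes H: "subgroup H G" and cocompact: "compact_space (coset_topology G T H)"
  shows "\<exists>r. \<forall>x\<in>carrier G. \<exists>h\<in>H. len (inv h \<otimes> x) \<le> r"
proof -
  let ?q = "\<lambda>x. H #> x"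
  have Hc: "H \<subseteq> carrier G" using H by (rule subgroup.subset)
  have q_eq: "?q x = ?q y \<longleftrightarrow> (\<exists>h\<in>H. x = h \<otimes> y)" if "x \<in> carrier G" "y \<in> carrier G" for x y
    using rcos_self[OF that(1) H] repr_independence[OF _ that(2) H, of x] that
    by (auto simp: r_coset_def)
  have top: "topspace (coset_topology G T H) = ?q ` carrier G"
    by (simp add: coset_topology_def topspace_quotient_topology topspace_eq)
  have "openin (coset_topology G T H) (?q ` tile a)" if a: "a \<in> carrier G" for a
  proof -
    have "{x \<in> carrier G. ?q x \<in> ?q ` tile a} = (\<Union>h\<in>H. {x \<in> carrier G. h \<otimes> x \<in> tile a})"
    proof (intro equalityI subsetI)
      fix x assume x: "x \<in> {x \<in> carrier G. ?q x \<in> ?q ` tile a}"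
      then obtain y where y: "y \<in> tile a" "?q y = ?q x" by auto
      have "y \<in> carrier G" using y by (simp add: tile_def)
      then show "x \<in> (\<Union>h\<in>H. {x \<in> carrier G. h \<otimes> x \<in> tile a})" using q_eq[of y x] x y by auto
    next
      fix x assume "x \<in> (\<Union>h\<in>H. {x \<in> carrier G. h \<otimes> x \<in> tile a})"
      then obtain h where h: "h \<in> H" "x \<in> carrier G" "h \<otimes> x \<in> tile a" by blast
      have "h \<otimes> x \<in> carrier G" using h(3) by (simp add: tile_def)
      then have "?q (h \<otimes> x) = ?q x" using q_eq[of "h \<otimes> x" x] h by blast
      then show "x \<in> {x \<in> carrier G. ?q x \<in> ?q ` tile a}" using h by (metis (mono_tags) image_eqI mem_Collect_eq)
    qed
    moreover have "openin T (\<Union>h\<in>H. {x \<in> carrier G. h \<otimes> x \<in> tile a})"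
      using openin_translate[OF openin_tile[OF a]] Hc by (intro openin_Union) auto
    ultimately show ?thesis
      by (auto simp: coset_topology_def openin_quotient_topology topspace_eq tile_def)
  qed
  then have opens: "openin (coset_topology G T H) U" if "U \<in> (\<lambda>a. ?q ` tile a) ` carrier G" for U
    using that by blast
  have cover: "?q ` carrier G \<subseteq> \<Union> ((\<lambda>a. ?q ` tile a) ` carrier G)" using in_some_tile by blast
  have "compactin (coset_topology G T H) (?q ` carrier G)"
    using cocompact top by (simp add: compact_space_def)
  from compactinD[OF this opens cover]
  obtain \<F> where \<F>: "finite \<F>" "\<F> \<subseteq> (\<lambda>a. ?q ` tile a) ` carrier G" "?q ` carrier G \<subseteq> \<Union> \<F>"
    by blast
  obtain F where F: "F \<subseteq> carrier G" "finite F" "\<F> = (\<lambda>a. ?q ` tile a) ` F"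
    using finite_subset_image[OF \<F>(1,2)] by blast
  obtain r where r: "\<forall>f\<in>F. \<forall>x\<in>carrier G. len (inv f \<otimes> x) \<le> width \<longrightarrow> len x \<le> r"
    using len_le_if_near_finite[OF F(2,1)] by blast
  have "\<exists>h\<in>H. len (inv h \<otimes> x) \<le> r" if x: "x \<in> carrier G" for x
  proof -
    obtain f y where fy: "f \<in> F" "y \<in> tile f" "?q x = ?q y"
      using \<F>(3) F(3) x by blast
    have y: "y \<in> carrier G" using fy(2) by (simp add: tile_def)
    obtain h where h: "h \<in> H" "x = h \<otimes> y" using q_eq[OF x y] fy(3) by blast
    have "inv h \<otimes> x = y" using h y Hc by (simp add: subset_iff flip: m_assoc)
    moreover have "len y \<le> r" using r fy(1) tile_len[OF fy(2)] y by blast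
    ultimately show ?thesis using h(1) by auto
  qed
  then show ?thesis by blast
qed

lemma (in compactly_generated_abelian_group) closed_subgroup:
  assumes H: "subgroup H G" and closed: "closedin T H"
    and gen: "compact_generating_set (G\<lparr>carrier := H\<rparr>) (subtopology T H) SH"
  shows "compactly_generated_abelian_group (G\<lparr>carrier := H\<rparr>) (subtopology T H) SH"
proof -
  have Hc: "H \<subseteq> carrier G" using H by (rule subgroup.subset)
  have grp: "group (G\<lparr>carrier := H\<rparr>)" using H by (rule subgroup_imp_group)
  have comm: "comm_group (G\<lparr>carrier := H\<rparr>)"
    by (rule group.group_comm_groupI[OF grp]) (use Hc m_comm in auto)
  have top: "topological_group (G\<lparr>carrier := H\<rparr>) (subtopology T H)"
  proof (intro topological_group.intro grp topological_group_axioms.intro)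
    show "topspace (subtopology T H) = carrier (G\<lparr>carrier := H\<rparr>)"
      using Hc topspace_eq by auto
    have "continuous_map (subtopology (prod_topology T T) (H \<times> H)) (subtopology T H) (\<lambda>(x, y). x \<otimes> y)"
      using continuous_map_from_subtopology[OF continuous_mult] subgroup.m_closed[OF H]
      by (auto simp: continuous_map_in_subtopology)
    then show "continuous_map (prod_topology (subtopology T H) (subtopology T H)) (subtopology T H)
        (\<lambda>(x, y). x \<otimes>\<^bsub>G\<lparr>carrier := H\<rparr>\<^esub> y)"
      by (simp add: subtopology_Times)
    have "continuous_map (subtopology T H) (subtopology T H) (\<lambda>x. inv x)"
      using continuous_map_from_subtopology[OF continuous_inv] subgroup.m_inv_closed[OF H]
      by (auto simp: continuous_map_in_subtopology)
    then show "continuous_map (subtopology T H) (subtopology T H) (\<lambda>x. inv\<^bsub>G\<lparr>carrier := H\<rparr>\<^esub> x)"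
      by (rule continuous_map_eq) (use m_inv_consistent[OF H] in auto)
  qed
  show ?thesis
    using comm top gen Hausdorff loc_compact closed
    by (intro compactly_generated_abelian_group.intro compactly_generated_abelian_group_axioms.intro
        Hausdorff_space_subtopology locally_compact_space_closed_subset)
qed

text \<open>Take a lattice of \<open>H\<close>. It is proper in \<open>G\<close> because a ball of \<open>G\<close> meets the closed set \<open>H\<close> in a compact set,
which is bounded in the word length of \<open>H\<close>. It is coarsely dense in \<open>G\<close> because \<open>H\<close> is, and balls of \<open>H\<close>
are compact, hence bounded in the word length of \<open>G\<close>.\<close>

lemma (in compactly_generated_abelian_group) common_lattice:
  assumes H: "subgroup H G" and closed: "closedin T H"
    and cocompact: "compact_space (coset_topology G T H)"
    and gen: "compact_generating_set (G\<lparr>carrier := H\<rparr>) (subtopology T H) SH"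
  shows "\<exists>g k. length_group.lattice (G\<lparr>carrier := H\<rparr>) (word_length (G\<lparr>carrier := H\<rparr>) SH) g k \<and> lattice g k"
proof -
  interpret H: compactly_generated_abelian_group "G\<lparr>carrier := H\<rparr>" "subtopology T H" SH
    by (rule closed_subgroup[OF H closed gen])
  have Hc: "H \<subseteq> carrier G" using H by (rule subgroup.subset)
  obtain g k where lat: "H.lattice g k" using H.lattice_exists by blast
  have gH: "range g \<subseteq> H" using lat by (simp add: H.lattice_def H.proper_def)
  then have gc: "range g \<subseteq> carrier G" using Hc by blast
  note eq = lattice_point_consistent[OF H gH] and inv_eq = m_inv_consistent[OF H]
  have hH: "lattice_point G g k z \<in> H" for z
    using H.lattice_point_closed[of g k z] gH by (simp add: eq)
  have "lattice g k"
    unfolding lattice_def proper_def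
  proof (intro conjI gc allI)
    fix r
    have "compactin (subtopology T H) (H \<inter> {x \<in> carrier G. len x \<le> r})"
      using closed_Int_compactin[OF closed compactin_ball] by (simp add: compactin_subtopology)
    then obtain r' where r': "\<forall>x\<in>H \<inter> {x \<in> carrier G. len x \<le> r}. H.len x \<le> r'"
      using H.compactin_bounded by blast
    obtain C where C: "\<And>z. H.len (lattice_point G g k z) \<le> r' \<Longrightarrow> \<forall>i<k. \<bar>z i\<bar> \<le> C"
      using lat unfolding H.lattice_def H.proper_def eq by metis
    have "\<forall>i<k. \<bar>z i\<bar> \<le> C" if "len (lattice_point G g k z) \<le> r" for z
      using C r' that hH[of z] Hc by blast
    then show "\<exists>C. \<forall>z. len (lattice_point G g k z) \<le> r \<longrightarrow> (\<forall>i<k. \<bar>z i\<bar> \<le> C)" by blast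
  next
    obtain D where D: "\<And>x. x \<in> H \<Longrightarrow> \<exists>z. H.len (inv (lattice_point G g k z) \<otimes> x) \<le> D"
      using lat hH unfolding H.lattice_def eq by (auto simp: inv_eq)
    have "compactin T {x \<in> H. H.len x \<le> D}"
      using H.compactin_ball[of D] by (simp add: compactin_subtopology)
    then obtain s where s: "\<forall>x\<in>{x \<in> H. H.len x \<le> D}. len x \<le> s" using compactin_bounded by blast
    obtain r where r: "\<forall>x\<in>carrier G. \<exists>h\<in>H. len (inv h \<otimes> x) \<le> r"
      using cocompact_finite_cover[OF H cocompact] by blast
    have "\<exists>z. len (inv (lattice_point G g k z) \<otimes> x) \<le> s + r" if x: "x \<in> carrier G" for x
    proof -
      obtain h where h: "h \<in> H" "len (inv h \<otimes> x) \<le> r" using r x by blast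
      obtain z where z: "H.len (inv (lattice_point G g k z) \<otimes> h) \<le> D" using D[OF h(1)] by blast
      let ?y = "lattice_point G g k z"
      have hc: "h \<in> carrier G" "?y \<in> carrier G" using h(1) Hc hH by auto
      have "inv ?y \<otimes> h \<in> H"
        using hH h(1) subgroup.m_closed[OF H] subgroup.m_inv_closed[OF H] by blast
      then have 1: "len (inv ?y \<otimes> h) \<le> s" using s z by blast
      have "(inv ?y \<otimes> h) \<otimes> (inv h \<otimes> x) = inv ?y \<otimes> x"
        using hc x by (simp add: m_assoc) (simp flip: m_assoc)
      then show ?thesis using len_mult[of "inv ?y \<otimes> h" "inv h \<otimes> x"] 1 h(2) hc x
        by (intro exI[of _ z]) simp
    qed
    then show "\<exists>D. \<forall>x\<in>carrier G. \<exists>z. len (inv (lattice_point G g k z) \<otimes> x) \<le> D" by blast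
  qed
  then show ?thesis using lat by blast
qed

section \<open>Boundaries of compactly generated abelian groups\<close>

theorem corollary5p7:
  fixes G :: "('a, 'm) monoid_scheme" and T :: "'a topology"
    and S :: "'a set" and p :: 'a
  assumes "comm_group G"
    and "topological_group G T"
    and "Hausdorff_space T"
    and "locally_compact_space T"
    and "compact_generating_set G T S"
    and "p \<in> carrier G"
  shows
    "(\<forall>(a::nat) (b::nat) (C :: 'c monoid) TC.
        comm_group C \<longrightarrow> topological_group C TC \<longrightarrow> compact_space TC \<longrightarrow>
        topologically_isomorphic G T (model_group a b C) (model_topology a b TC) \<longrightarrow>
          linear_boundary G S p homeomorphic_space sphere_in (a + b) \<and>
          projective_boundary G S p homeomorphic_space projective_in (a + b))
     \<and>
     (\<forall>H SH q.
        subgroup H G \<longrightarrow> closedin T H \<longrightarrow> compact_space (coset_topology G T H) \<longrightarrow>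
        compact_generating_set (G\<lparr>carrier := H\<rparr>) (subtopology T H) SH \<longrightarrow> q \<in> H \<longrightarrow>
          linear_boundary (G\<lparr>carrier := H\<rparr>) SH q homeomorphic_space linear_boundary G S p \<and>
          projective_boundary (G\<lparr>carrier := H\<rparr>) SH q homeomorphic_space projective_boundary G S p)"
proof -
  interpret compactly_generated_abelian_group G T S
    using assms by (intro compactly_generated_abelian_group.intro
        compactly_generated_abelian_group_axioms.intro)
  show ?thesis
  proof (intro conjI[of "\<forall>a b C TC. _ a b C TC"] allI impI)
    fix a b :: nat and C :: "'c monoid" and TC
    assume "comm_group C" "topological_group C TC" "compact_space TC"
      "topologically_isomorphic G T (model_group a b C) (model_topology a b TC)"
    then obtain g where "lattice g (a + b)" using lattice_of_model by blast
    then show "linear_boundary G S p homeomorphic_space sphere_in (a + b) \<and>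
        projective_boundary G S p homeomorphic_space projective_in (a + b)"
      using boundaries_if_lattice assms(6) by blast
  next
    fix H SH q
    assume H: "subgroup H G" "closedin T H" "compact_space (coset_topology G T H)"
      "compact_generating_set (G\<lparr>carrier := H\<rparr>) (subtopology T H) SH" and q: "q \<in> H"
    interpret H: compactly_generated_abelian_group "G\<lparr>carrier := H\<rparr>" "subtopology T H" SH
      by (rule closed_subgroup[OF H(1,2,4)])
    obtain g k where lat: "H.lattice g k" "lattice g k" using common_lattice[OF H] by blast
    have qH: "q \<in> carrier (G\<lparr>carrier := H\<rparr>)" using q by simp
    note HB = H.boundaries_if_lattice[OF lat(1) qH] and GB = boundaries_if_lattice[OF lat(2) assms(6)]
    show "linear_boundary (G\<lparr>carrier := H\<rparr>) SH q homeomorphic_space linear_boundary G S p \<and>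
        projective_boundary (G\<lparr>carrier := H\<rparr>) SH q homeomorphic_space projective_boundary G S p"
      using homeomorphic_space_trans[OF HB(1) homeomorphic_space_sym[THEN iffD1, OF GB(1)]]
        homeomorphic_space_trans[OF HB(2) homeomorphic_space_sym[THEN iffD1, OF GB(2)]] by (rule conjI)
  qed
qed

end
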